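(* Consider the algorithm DPSDA-PS over $B$-strongly connected time-varying directed graphs $\{\mathcal{G}_2(t)\}_{t\in\mathbb{Z}_0}$ with privacy parameter $\epsilon>0$, and suppose conditions (a)-(e) and the stochastic gradient condition (S) listed in the context hold. With the step-size $\alpha(t)=1/\sqrt t$, the pseudo-regret of DPSDA-PS satisfies, for every $T\in\mathbb{Z}_+$, $$\bar{\mathcal{R}}(\mathbf{x}(t),T)\le M_2\sqrt{T},$$ where $$M_2=\frac{16n^2\hat L^2}{\epsilon^2}+2n\hat L^2+C+2\big(L+\sqrt{n}D_\chi G\big)\sqrt{\frac{8n^3\beta^2\hat L^2}{\gamma^2\lambda^2(1-\lambda)^2}+\frac{64n^5\beta^2\hat L^2}{\gamma^2(1-\lambda)^2\epsilon^2}},$$ with $\gamma=\inf_{t\ge0}\big(\min_{1\le i\le n}[A(t:0)\mathbf{1}]_i\big)$, $\beta=2$ and $\lambda=(1-1/n^{nB})^{1/B}$.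
   Context: Setting. $\mathcal{V}=\{1,\dots,n\}$; $\chi\subset\mathbb{R}$; $f_t:\chi^n\to\mathbb{R}$ (possibly random) is revealed at time $t$ after the decisions $\mathbf{x}(t)=[x_1(t),\dots,x_n(t)]^\top\in\chi^n$ are made. Pseudo-regret: $\bar{\mathcal{R}}(\mathbf{x}(t),T)=\mathbb{E}[\sum_{t=1}^T f_t(\mathbf{x}(t))]-\inf_{\mathbf{v}\in\chi^n}\mathbb{E}[\sum_{t=1}^T f_t(\mathbf{v})]$. Network. $\mathcal{G}_2(t)=(\mathcal{V},\mathcal{E}(t))$ is a time-varying digraph such that for some integer $B>0$ the union $\bigcup_{k=(t-1)B+1}^{tB}\mathcal{E}(k)$ is strongly connected for every $t\in\mathbb{Z}_+$; $(i,j)\in\mathcal{E}(t)$ means $i$ can send to $j$; $\mathcal{N}_i^{\mathrm{in}}(t)=\{j:(j,i)\in\mathcal{E}(t)\}\cup\{i\}$, $\deg_j^{\mathrm{out}}(t)=|\{l:(j,l)\in\mathcal{E}(t)\}\cup\{j\}|$. The column-stochastic matrix $A(t)$ is $[A(t)]_{ij}=1/\deg_j^{\mathrm{out}}(t)$ if $j\in\mathcal{N}_i^{\mathrm{in}}(t)$ and $0$ otherwise. $A(t:s)=A(t)\cdots A(s)$ for $t\ge s\ge0$. DPSDA-PS: $\mathbf{z}_i(0)=\mathbf{0}$, $w_i(0)=1$ and, for $t=0,1,\dots$ and $i,k\in\mathcal{V}$, $\mathbf{h}_i(t)=\mathbf{z}_i(t)+\boldsymbol{\eta}_i(t)$; $z_i^k(t+1)=n\delta_i^k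 u_i(t)+\sum_{j=1}^n[A(t)]_{ij}h_j^k(t)$; $w_i(t+1)=\sum_{j=1}^n[A(t)]_{ij}w_j(t)$; $\mathbf{y}_i(t+1)=\Pi^\psi_{\chi^n}(\mathbf{z}_i(t+1)/w_i(t+1),\alpha(t))$; $x_i(t+1)=y_i^i(t+1)$. Here superscript $k$ is the $k$-th coordinate, $\delta_i^k$ is the Kronecker delta, $\Pi^{\psi}_{\chi^n}(\mathbf{z},\alpha)=\arg\min_{\mathbf{x}\in\chi^n}\{\langle\mathbf{z},\mathbf{x}\rangle+\frac1\alpha\psi(\mathbf{x})\}$ with $\psi:\chi^n\to[0,\infty)$ $1$-strongly convex, and $u_i(t)=\tilde g_i(t)=\langle\nabla f_t(\mathbf{y}_i(t)),\mathbf{e}_i\rangle+\xi_i(t)$ with $\xi_i(t)$ a random error. The step-size is $\alpha(t)=1/\sqrt t$ for $t\ge1$, with $\alpha(0)=1$. Noise. $\boldsymbol{\eta}_i(t)\in\mathbb{R}^n$ has independent coordinates with Laplace density $\frac{1}{2\sigma(t)}e^{-|x|/\sigma(t)}$, independent over $i$ and $t$, with $\sigma(t)=\Delta(t)/\epsilon$, where $\Delta(t)$ is the sensitivity of the algorithm at step $t$ (the largest $1$-norm change of a dual variable caused by changing one function of the sequence $\{f_t\}$), which satisfies $\Delta(t)\le2n\hat L$. Conditions: (a) each $f_t$ is convex; (b) $\psi(\mathbf{y})\le C$ for all $\mathbf{y}\in\chi^n$, some $C>0$; (c) $\chi^n$ is nonempty, convex, closed, with $D_\chi=\sup_{x,y\in\chi}|x-y|$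 finite; (d) $\|\nabla f_t(\mathbf{y})\|\le L$ for all $t\in\mathbb{Z}_0$, $\mathbf{y}\in\chi^n$, some $L>0$; (e) $\|\nabla f_t(\mathbf{x})-\nabla f_t(\mathbf{y})\|\le G\|\mathbf{x}-\mathbf{y}\|$ for all $t$, $\mathbf{x},\mathbf{y}\in\chi^n$, some $G>0$. (S): with $\mathcal{F}_t$ the entire history generated by the algorithm up to time $t$, for all $i\in\mathcal{V}$, $t\in\mathbb{Z}_0$: $\mathbb{E}[\tilde g_i(t)\mid\mathcal{F}_{t-1}]=\langle\nabla f_t(\mathbf{y}_i(t)),\mathbf{e}_i\rangle$ and $\mathbb{E}[|\tilde g_i(t)|^2\mid\mathcal{F}_{t-1}]\le\hat L^2$ for some $\hat L>0$. *)

theory Defs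
  imports "HOL-Probability.Probability"
begin

text \<open>The nodes are the elements of a finite type \<open>'n\<close>, so \<open>n = CARD('n)\<close>. A family of \<open>n\<close> vectors
  of dimension \<open>n\<close>, one per node, is a matrix whose row \<open>i\<close> is the vector held by node \<open>i\<close>.\<close>

definition cart_power :: "real set \<Rightarrow> (real ^ 'n) set" where
  "cart_power chi = {v. \<forall>i. v $ i \<in> chi}"

definition B_strongly_connected :: "nat \<Rightarrow> (nat \<Rightarrow> ('n \<times> 'n) set) \<Rightarrow> bool" where
  "B_strongly_connected B E \<longleftrightarrow>
     0 < B \<and> (\<forall>t\<ge>1. \<forall>i j. (i, j) \<in> (\<Union>k\<in>{(t - 1) * B + 1..t * B}. E k)\<^sup>*)"

definition in_nbrs :: "('n \<times> 'n) set \<Rightarrow> 'n \<Rightarrow> 'n set" where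
  "in_nbrs E i = {j. (j, i) \<in> E} \<union> {i}"

definition out_deg :: "('n \<times> 'n) set \<Rightarrow> 'n \<Rightarrow> nat" where
  "out_deg E j = card ({l. (j, l) \<in> E} \<union> {j})"

definition weight_mat :: "('n::finite \<times> 'n) set \<Rightarrow> real ^ 'n ^ 'n" where
  "weight_mat E = (\<chi> i j. if j \<in> in_nbrs E i then 1 / real (out_deg E j) else 0)"

text \<open>\<open>mat_prod A t s\<close> is \<open>A t ** \<dots> ** A s\<close>; it is meant for \<open>s \<le> t\<close> only.\<close>

primrec mat_prod :: "(nat \<Rightarrow> real ^ 'n ^ 'n) \<Rightarrow> nat \<Rightarrow> nat \<Rightarrow> real ^ 'n ^ 'n" where
  "mat_prod A 0 s = A 0"
| "mat_prod A (Suc t) s = (if s \<le> t then A (Suc t) ** mat_prod A t s else A (Suc t))"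

definition strongly_convex_on :: "real \<Rightarrow> 'a::real_inner set \<Rightarrow> ('a \<Rightarrow> real) \<Rightarrow> bool" where
  "strongly_convex_on \<mu> S f \<longleftrightarrow>
     (\<forall>x\<in>S. \<forall>y\<in>S. \<forall>c\<in>{0..1}.
        f ((1 - c) *\<^sub>R x + c *\<^sub>R y)
          \<le> (1 - c) * f x + c * f y - \<mu> / 2 * c * (1 - c) * (norm (x - y))\<^sup>2)"

text \<open>The derivative is taken within the domain \<open>S\<close> of the function, so at boundary points only
  directions into \<open>S\<close> matter.\<close>

definition gradient_on :: "'a::real_inner set \<Rightarrow> ('a \<Rightarrow> real) \<Rightarrow> ('a \<Rightarrow> 'a) \<Rightarrow> bool" where
  "gradient_on S f df \<longleftrightarrow> (\<forall>x\<in>S. (f has_derivative (\<lambda>d. df x \<bullet> d)) (at x within S))"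

definition step_size :: "nat \<Rightarrow> real" where
  "step_size t = (if t = 0 then 1 else 1 / sqrt (real t))"

text \<open>\<open>is_prox X \<psi> z \<alpha> v\<close> says that \<open>v\<close> is the projection of \<open>z\<close>. For a strongly convex \<open>\<psi>\<close> there is
  at most one such \<open>v\<close>; the relational form avoids choosing a value when the minimum is not
  attained, as can happen if \<open>\<psi>\<close> is not lower semicontinuous on the boundary of \<open>X\<close>.\<close>

definition is_prox ::
    "(real ^ 'n) set \<Rightarrow> (real ^ 'n \<Rightarrow> real) \<Rightarrow> real ^ 'n \<Rightarrow> real \<Rightarrow> real ^ 'n \<Rightarrow> bool" where
  "is_prox X psi z a v \<longleftrightarrow> is_arg_min (\<lambda>x. z \<bullet> x + 1 / a * psi x) (\<lambda>x. x \<in> X) v"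

text \<open>One realisation of the algorithm, for gradients \<open>df\<close>, gradient errors \<open>xi\<close> and privacy noise
  \<open>eta\<close>. The initial points \<open>y 0 $ i\<close>, at which the first gradients are evaluated, are arbitrary
  in \<open>X\<close>, and \<open>x 0\<close> is irrelevant.\<close>

definition dpsda_ps_run ::
    "(real ^ 'n) set \<Rightarrow> (real ^ 'n \<Rightarrow> real) \<Rightarrow> (nat \<Rightarrow> ('n::finite \<times> 'n) set)
     \<Rightarrow> (nat \<Rightarrow> real ^ 'n \<Rightarrow> real ^ 'n) \<Rightarrow> (nat \<Rightarrow> real ^ 'n) \<Rightarrow> (nat \<Rightarrow> real ^ 'n ^ 'n)
     \<Rightarrow> (nat \<Rightarrow> real ^ 'n ^ 'n) \<Rightarrow> (nat \<Rightarrow> real ^ 'n ^ 'n) \<Rightarrow> (nat \<Rightarrow> real ^ 'n)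
     \<Rightarrow> (nat \<Rightarrow> real ^ 'n) \<Rightarrow> (nat \<Rightarrow> real ^ 'n ^ 'n) \<Rightarrow> (nat \<Rightarrow> real ^ 'n) \<Rightarrow> bool" where
  "dpsda_ps_run X psi E df xi eta z h w u y x \<longleftrightarrow>
     (\<forall>i. z 0 $ i = 0 \<and> w 0 $ i = 1 \<and> y 0 $ i \<in> X) \<and>
     (\<forall>t i.
        h t $ i = z t $ i + eta t $ i \<and>
        u t $ i = df t (y t $ i) \<bullet> axis i 1 + xi t $ i \<and>
        (\<forall>k. z (Suc t) $ i $ k =
           real CARD('n) * (if i = k then 1 else 0) * u t $ i
             + (\<Sum>j\<in>UNIV. weight_mat (E t) $ i $ j * h t $ j $ k)) \<and>
        w (Suc t) $ i = (\<Sum>j\<in>UNIV. weight_mat (E t) $ i $ j * w t $ j) \<and>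
        is_prox X psi ((1 / w (Suc t) $ i) *\<^sub>R z (Suc t) $ i) (step_size t) (y (Suc t) $ i) \<and>
        x (Suc t) $ i = y (Suc t) $ i $ i)"

text \<open>A sequence of losses together with dual variables that the algorithm may produce from it.\<close>

definition dual_run ::
    "(real ^ 'n) set \<Rightarrow> (real ^ 'n \<Rightarrow> real) \<Rightarrow> (nat \<Rightarrow> ('n::finite \<times> 'n) set)
     \<Rightarrow> (nat \<Rightarrow> real ^ 'n \<Rightarrow> real) \<Rightarrow> (nat \<Rightarrow> real ^ 'n ^ 'n) \<Rightarrow> bool" where
  "dual_run X psi E l z \<longleftrightarrow>
     (\<exists>dl xi eta h w u y x.
        (\<forall>t. gradient_on X (l t) (dl t)) \<and> dpsda_ps_run X psi E dl xi eta z h w u y x)"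

definition adjacent :: "'b set \<Rightarrow> (nat \<Rightarrow> 'b \<Rightarrow> real) \<Rightarrow> (nat \<Rightarrow> 'b \<Rightarrow> real) \<Rightarrow> bool" where
  "adjacent X l l' \<longleftrightarrow> (\<exists>s. \<forall>t. t \<noteq> s \<longrightarrow> (\<forall>v\<in>X. l t v = l' t v))"

text \<open>\<open>R\<close> is the set of compared pairs of runs on adjacent loss sequences. It fixes what the two runs
  share besides the losses (the same realisation of the noise, or the same broadcast messages).
  The supremum is taken in \<^typ>\<open>ennreal\<close>, so that it always exists.\<close>

definition run_pairs ::
    "(real ^ 'n) set \<Rightarrow> (real ^ 'n \<Rightarrow> real) \<Rightarrow> (nat \<Rightarrow> ('n::finite \<times> 'n) set)
     \<Rightarrow> (((nat \<Rightarrow> real ^ 'n \<Rightarrow> real) \<times> (nat \<Rightarrow> real ^ 'n ^ 'n)) \<times>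
         ((nat \<Rightarrow> real ^ 'n \<Rightarrow> real) \<times> (nat \<Rightarrow> real ^ 'n ^ 'n))) set" where
  "run_pairs X psi E =
     {((l, z), (l', z')). dual_run X psi E l z \<and> dual_run X psi E l' z' \<and> adjacent X l l'}"

definition sensitivity ::
    "(((nat \<Rightarrow> real ^ 'n \<Rightarrow> real) \<times> (nat \<Rightarrow> real ^ 'n ^ 'n)) \<times>
      ((nat \<Rightarrow> real ^ 'n \<Rightarrow> real) \<times> (nat \<Rightarrow> real ^ 'n ^ 'n))) set \<Rightarrow> nat \<Rightarrow> ennreal" where
  "sensitivity R t =
     (SUP ((l, z), (l', z'))\<in>R. SUP i. ennreal (\<Sum>k\<in>UNIV. \<bar>z t $ i $ k - z' t $ i $ k\<bar>))"

text \<open>The Laplace distribution of scale \<open>s\<close>, read as the point mass at \<open>0\<close> if \<open>s = 0\<close>. The degenerate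
  case does occur: all dual variables start at \<open>0\<close>, so the sensitivity at step \<open>0\<close> is \<open>0\<close>.\<close>

definition laplace_distributed :: "'a measure \<Rightarrow> ('a \<Rightarrow> real) \<Rightarrow> real \<Rightarrow> bool" where
  "laplace_distributed M N s \<longleftrightarrow>
     N \<in> borel_measurable M \<and>
     (if s = 0 then AE \<omega> in M. N \<omega> = 0
      else distributed M lborel N (\<lambda>x. ennreal (1 / (2 * s) * exp (- \<bar>x\<bar> / s))))"

definition preimages :: "'a measure \<Rightarrow> ('a \<Rightarrow> 'b::topological_space) \<Rightarrow> 'a set set" where
  "preimages M Y = {Y -` S \<inter> space M | S. S \<in> sets borel}"

text \<open>\<open>history M z h u y t\<close> is the sigma-algebra of everything generated strictly before time \<open>t\<close>,
  including the initial points. It determines \<open>z t\<close> and \<open>y t\<close>.\<close>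

definition history ::
    "'a measure \<Rightarrow> (nat \<Rightarrow> 'a \<Rightarrow> real ^ 'n ^ 'n) \<Rightarrow> (nat \<Rightarrow> 'a \<Rightarrow> real ^ 'n ^ 'n)
     \<Rightarrow> (nat \<Rightarrow> 'a \<Rightarrow> real ^ 'n) \<Rightarrow> (nat \<Rightarrow> 'a \<Rightarrow> real ^ 'n ^ 'n) \<Rightarrow> nat \<Rightarrow> 'a measure" where
  "history M z h u y t =
     sigma (space M)
       (preimages M (y 0) \<union>
        (\<Union>s<t. preimages M (z s) \<union> preimages M (h s) \<union> preimages M (u s) \<union> preimages M (y s)))"

definition pseudo_regret ::
    "'a measure \<Rightarrow> 'b set \<Rightarrow> (nat \<Rightarrow> 'a \<Rightarrow> 'b \<Rightarrow> real) \<Rightarrow> (nat \<Rightarrow> 'a \<Rightarrow> 'b) \<Rightarrow> nat \<Rightarrow> real" where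
  "pseudo_regret M X f x T =
     (\<integral>\<omega>. (\<Sum>t=1..T. f t \<omega> (x t \<omega>)) \<partial>M) - (INF v\<in>X. \<integral>\<omega>. (\<Sum>t=1..T. f t \<omega> v) \<partial>M)"

end

theory Submission
  imports Defs
begin

text \<open>
  Since the weight matrices are column stochastic, the average of the dual variables follows the
  centralised dual averaging recursion driven by the stochastic gradients and the averaged noise.
  Its proximal points satisfy the usual dual averaging regret bound, where the second moment of the
  averaged noise is small because the noise is independent over the nodes. The iterate of a node
  differs from the centralised one by at most \<open>1 / \<gamma>\<close> times a sum of past inputs, weighted by the
  oscillation of the rows of \<open>A(t:s)\<close>. A product over \<open>n - 1\<close> windows of \<open>B\<close> steps has all
  entries at least \<open>1 / n ^ ((n - 1) * B)\<close>, so this oscillation contracts faster than \<open>lam\<close>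
  suggests, and the disagreement uses up only half of the last term of \<open>M2\<close>.

  The other half pays for the input at time \<open>0\<close>, which enters the dual variables but not the regret. It
  costs its norm times the diameter \<open>d = sqrt n * D\<close>. If \<open>L * d * sqrt T \<le> C\<close>, the regret bound is
  trivial by the Lipschitz property. Otherwise strong convexity gives \<open>d\<^sup>2 \<le> 8 * C\<close> and hence
  \<open>d \<le> 8 * L * sqrt T\<close>.
\<close>

section \<open>The regularised minimisation without attainment\<close>

text \<open>Two index effects shape the argument. The centralised point of index \<open>t\<close>
  uses the inputs at times \<open>0\<close> to \<open>t\<close> and is compared with the loss at
  time \<open>t + 1\<close>. Hence it is known before the gradient error and the noise of time
  \<open>t + 1\<close> are drawn, and these have mean zero against it. By the same shift the input
  at time \<open>0\<close> never meets a loss. The second effect is alignment: connectivity is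
  assumed only for the blocks from \<open>k * B + 1\<close> to \<open>(k + 1) * B\<close>, so up to
  \<open>B\<close> of any \<open>n * B\<close> steps are lost before a block begins, which leaves
  \<open>n - 1\<close> whole blocks. The oscillation then loses the fraction
  \<open>n / n ^ ((n - 1) * B)\<close> per \<open>n * B\<close> steps, whereas \<open>lam\<close>
  raised to \<open>n * B\<close> is \<open>(1 - 1 / n ^ (n * B)) ^ n\<close> and loses at most
  \<open>n / n ^ (n * B)\<close>. The surplus \<open>n ^ B\<close> is at least \<open>n\<close>;
  this factor brings inputs of expected size \<open>n ^ 2\<close> down to the \<open>n ^ 3\<close>
  under the root in \<open>M2\<close>.\<close>

definition prox_val :: "'a::real_inner set \<Rightarrow> ('a \<Rightarrow> real) \<Rightarrow> real \<Rightarrow> 'a \<Rightarrow> real" where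
  "prox_val X psi a z = (INF x\<in>X. z \<bullet> x + 1 / a * psi x)"

locale prox_function =
  fixes X :: "'a::euclidean_space set" and psi :: "'a \<Rightarrow> real"
  assumes nonempty: "X \<noteq> {}" and convex_X: "convex X" and closed_X: "closed X"
    and bounded_X: "bounded X"
    and psi_nonneg: "\<And>x. x \<in> X \<Longrightarrow> 0 \<le> psi x"
    and psi_strongly_convex: "strongly_convex_on 1 X psi"
begin

lemma bdd_below_objective:
  assumes "a > 0"
  shows "bdd_below ((\<lambda>x. z \<bullet> x + 1 / a * psi x) ` X)"
proof -
  obtain K where K: "\<And>x. x \<in> X \<Longrightarrow> norm x \<le> K"
    using bounded_X by (auto simp: bounded_iff)
  have "- (norm z * K) \<le> z \<bullet> x + 1 / a * psi x" if "x \<in> X" for x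
  proof -
    have "- (norm z * norm x) \<le> z \<bullet> x"
      using Cauchy_Schwarz_ineq2[of z x] by linarith
    moreover have "norm z * norm x \<le> norm z * K"
      using K that by (simp add: mult_left_mono)
    moreover have "0 \<le> 1 / a * psi x" using assms psi_nonneg that by simp
    ultimately show ?thesis by linarith
  qed
  then show ?thesis by (intro bdd_belowI2)
qed

lemma prox_val_le:
  assumes "a > 0" "x \<in> X"
  shows "prox_val X psi a z \<le> z \<bullet> x + 1 / a * psi x"
  unfolding prox_val_def by (rule cINF_lower[OF bdd_below_objective[OF assms(1)] assms(2)])

lemma prox_val_ge:
  assumes "\<And>x. x \<in> X \<Longrightarrow> c \<le> z \<bullet> x + 1 / a * psi x"
  shows "c \<le> prox_val X psi a z"
  unfolding prox_val_def by (rule cINF_greatest[OF nonempty assms])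

lemma prox_val_antimono:
  assumes "0 < b" "b \<le> a"
  shows "prox_val X psi a z \<le> prox_val X psi b z"
proof (rule prox_val_ge)
  fix x assume x: "x \<in> X"
  have "prox_val X psi a z \<le> z \<bullet> x + 1 / a * psi x"
    using assms x by (intro prox_val_le) auto
  also have "1 / a * psi x \<le> 1 / b * psi x"
    using assms psi_nonneg[OF x] by (intro mult_right_mono) (auto simp: field_simps)
  finally show "prox_val X psi a z \<le> z \<bullet> x + 1 / b * psi x" by simp
qed

text \<open>The values have their own limit because the objective at \<open>y\<close> may lie above
  \<open>prox_val\<close> when \<open>psi\<close> is not lower semicontinuous.\<close>

definition prox_limit :: "real \<Rightarrow> 'a \<Rightarrow> (nat \<Rightarrow> 'a) \<Rightarrow> 'a \<Rightarrow> bool" where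
  "prox_limit a z s y \<longleftrightarrow> (\<forall>k. s k \<in> X) \<and> s \<longlonglongrightarrow> y \<and>
     (\<lambda>k. z \<bullet> s k + 1 / a * psi (s k)) \<longlonglongrightarrow> prox_val X psi a z"

lemma prox_limit_exists:
  assumes "a > 0"
  shows "\<exists>y. y \<in> X \<and> (\<exists>s. prox_limit a z s y)"
proof -
  define F where "F x = z \<bullet> x + 1 / a * psi x" for x
  have "\<exists>x\<in>X. F x < prox_val X psi a z + 1 / real (Suc k)" for k
  proof -
    have "Inf (F ` X) < prox_val X psi a z + 1 / real (Suc k)"
      by (simp add: prox_val_def F_def)
    then obtain q where "q \<in> F ` X" "q < prox_val X psi a z + 1 / real (Suc k)"
      using cInf_lessD[of "F ` X"] nonempty by blast
    then show ?thesis by blast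
  qed
  then obtain s where s: "\<And>k. s k \<in> X" "\<And>k. F (s k) < prox_val X psi a z + 1 / real (Suc k)"
    by metis
  have "compact X" using bounded_X closed_X by (simp add: compact_eq_bounded_closed)
  then obtain y r where y: "y \<in> X" "strict_mono (r::nat\<Rightarrow>nat)" "(s \<circ> r) \<longlonglongrightarrow> y"
    using s(1) unfolding compact_def by metis
  have up: "(\<lambda>k. prox_val X psi a z + 1 / real (Suc k)) \<longlonglongrightarrow> prox_val X psi a z"
    using tendsto_add[OF tendsto_const LIMSEQ_Suc[OF lim_1_over_n]] by force
  have "(\<lambda>k. F (s k)) \<longlonglongrightarrow> prox_val X psi a z"
  proof (rule tendsto_sandwich[OF _ _ tendsto_const up])
    show "\<forall>\<^sub>F k in sequentially. prox_val X psi a z \<le> F (s k)"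
      unfolding F_def using prox_val_le[OF assms s(1)] by simp
    show "\<forall>\<^sub>F k in sequentially. F (s k) \<le> prox_val X psi a z + 1 / real (Suc k)"
      using s(2) by (simp add: less_imp_le)
  qed
  then have "((\<lambda>k. F (s k)) \<circ> r) \<longlonglongrightarrow> prox_val X psi a z"
    using y(2) by (rule LIMSEQ_subseq_LIMSEQ)
  then have "prox_limit a z (s \<circ> r) y"
    unfolding prox_limit_def using y s(1) by (auto simp: F_def o_def)
  then show ?thesis using y by blast
qed

text \<open>Strong convexity is applied on the segment from \<open>s k\<close> to \<open>x\<close>.
  The sequence must reach its limit for fixed \<open>c\<close> before \<open>c\<close> tends to 0:
  the objective at \<open>s k\<close> exceeds the infimum, and dividing by a small \<open>c\<close>
  would magnify that error.\<close>

lemma prox_limit_growth: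
  assumes a: "a > 0" and s: "prox_limit a z s y" and x: "x \<in> X"
  shows "prox_val X psi a z + 1 / (2 * a) * (norm (x - y))\<^sup>2 \<le> z \<bullet> x + 1 / a * psi x"
proof -
  define F where "F x = z \<bullet> x + 1 / a * psi x" for x
  let ?V = "prox_val X psi a z"
  have sX: "\<And>k. s k \<in> X" and sy: "s \<longlonglongrightarrow> y" and FV: "(\<lambda>k. F (s k)) \<longlonglongrightarrow> ?V"
    using s by (auto simp: prox_limit_def F_def)
  have step: "?V \<le> F x - (1 - c) / (2 * a) * (norm (x - y))\<^sup>2" if c: "0 < c" "c < 1" for c
  proof -
    have "?V \<le> (1 - c) * F (s k) + c * F x - c * (1 - c) / (2 * a) * (norm (s k - x))\<^sup>2" for k
    proof -
      let ?m = "(1 - c) *\<^sub>R s k + c *\<^sub>R x"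
      have m: "?m \<in> X" using convexD_alt[OF convex_X sX x] c by auto
      have "psi ?m \<le> (1 - c) * psi (s k) + c * psi x - 1 / 2 * c * (1 - c) * (norm (s k - x))\<^sup>2"
        using psi_strongly_convex sX[of k] x c unfolding strongly_convex_on_def by auto
      then have "1 / a * psi ?m
          \<le> 1 / a * ((1 - c) * psi (s k) + c * psi x - 1 / 2 * c * (1 - c) * (norm (s k - x))\<^sup>2)"
        using a by (intro mult_left_mono) auto
      also have "\<dots> = (1 - c) * (1 / a * psi (s k)) + c * (1 / a * psi x)
          - c * (1 - c) / (2 * a) * (norm (s k - x))\<^sup>2"
        using a by (simp add: field_simps)
      finally have "F ?m \<le> (1 - c) * F (s k) + c * F x - c * (1 - c) / (2 * a) * (norm (s k - x))\<^sup>2"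
        by (simp add: F_def inner_right_distrib distrib_left)
      moreover have "?V \<le> F ?m" unfolding F_def by (rule prox_val_le[OF a m])
      ultimately show ?thesis by linarith
    qed
    moreover have "(\<lambda>k. (1 - c) * F (s k) + c * F x - c * (1 - c) / (2 * a) * (norm (s k - x))\<^sup>2)
        \<longlonglongrightarrow> (1 - c) * ?V + c * F x - c * (1 - c) / (2 * a) * (norm (y - x))\<^sup>2"
      by (intro tendsto_intros FV sy)
    ultimately have "?V \<le> (1 - c) * ?V + c * F x - c * (1 - c) / (2 * a) * (norm (y - x))\<^sup>2"
      by (intro LIMSEQ_le_const) auto
    then have "c * ?V \<le> c * (F x - (1 - c) / (2 * a) * (norm (x - y))\<^sup>2)"
      by (simp add: algebra_simps norm_minus_commute)
    then show ?thesis using c by simp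
  qed
  \<comment> \<open>The choice \<open>c = 1 / (k + 2)\<close> keeps \<open>c\<close> strictly
    between 0 and 1 for every \<open>k\<close>.\<close>
  have lim: "(\<lambda>k. F x - (1 - 1 / real (Suc (Suc k))) / (2 * a) * (norm (x - y))\<^sup>2)
      \<longlonglongrightarrow> F x - (1 - 0) / (2 * a) * (norm (x - y))\<^sup>2"
    by (intro tendsto_intros LIMSEQ_Suc[OF LIMSEQ_Suc[OF lim_1_over_n]]) (use a in auto)
  have "?V \<le> F x - (1 - 0) / (2 * a) * (norm (x - y))\<^sup>2"
    by (rule LIMSEQ_le_const[OF lim]) (intro exI[of _ 0] allI impI step, auto)
  then show ?thesis by (simp add: F_def)
qed

text \<open>Without lower semicontinuity of \<open>psi\<close> the minimum need not be attained; the limit of a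
  minimising sequence is then a substitute for the minimiser.\<close>

definition prox :: "real \<Rightarrow> 'a \<Rightarrow> 'a" where
  "prox a z = (SOME y. y \<in> X \<and> (\<exists>s. prox_limit a z s y))"

lemma prox:
  assumes "a > 0"
  shows "prox a z \<in> X" "\<exists>s. prox_limit a z s (prox a z)"
  using someI_ex[OF prox_limit_exists[OF assms, of z]] by (auto simp: prox_def)

text \<open>Growth for \<open>z'\<close> is evaluated along the minimising sequence of
  \<open>z\<close>. The two objectives differ by a linear term only, so the limit is taken without
  evaluating \<open>psi\<close> at the limit point.\<close>

lemma prox_val_growth:
  assumes a: "a > 0"
  shows "prox_val X psi a z' + 1 / (2 * a) * (norm (prox a z - prox a z'))\<^sup>2
    \<le> prox_val X psi a z + (z' - z) \<bullet> prox a z"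
proof -
  obtain s where s: "prox_limit a z s (prox a z)" using prox(2)[OF a] by blast
  obtain s' where s': "prox_limit a z' s' (prox a z')" using prox(2)[OF a] by blast
  have lim: "s \<longlonglongrightarrow> prox a z"
    "(\<lambda>k. z \<bullet> s k + 1 / a * psi (s k)) \<longlonglongrightarrow> prox_val X psi a z"
    using s by (auto simp: prox_limit_def)
  have "prox_val X psi a z' + 1 / (2 * a) * (norm (s k - prox a z'))\<^sup>2
      \<le> (z \<bullet> s k + 1 / a * psi (s k)) + (z' - z) \<bullet> s k" for k
    using prox_limit_growth[OF a s', of "s k"] s
    by (auto simp: prox_limit_def inner_diff_left)
  then show ?thesis
    by (intro LIMSEQ_le[where X = "\<lambda>k. prox_val X psi a z' + 1 / (2 * a) * (norm (s k - prox a z'))\<^sup>2"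
          and Y = "\<lambda>k. (z \<bullet> s k + 1 / a * psi (s k)) + (z' - z) \<bullet> s k"] tendsto_intros lim) auto
qed

text \<open>Adding the growth inequality to its copy with \<open>z\<close> and \<open>z'\<close>
  exchanged cancels both values and leaves strong monotonicity with modulus
  \<open>1 / a\<close>.\<close>

lemma prox_lipschitz:
  assumes a: "a > 0"
  shows "norm (prox a z - prox a z') \<le> a * norm (z - z')"
proof -
  let ?d = "prox a z - prox a z'"
  have "1 / (2 * a) * (norm ?d)\<^sup>2 + 1 / (2 * a) * (norm ?d)\<^sup>2 \<le> (z' - z) \<bullet> ?d"
    using prox_val_growth[OF a, of z' z] prox_val_growth[OF a, of z z']
    by (simp add: inner_diff_left inner_diff_right norm_minus_commute)
  also have "\<dots> \<le> norm (z' - z) * norm ?d" by (rule norm_cauchy_schwarz)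
  finally have "(norm ?d)\<^sup>2 \<le> a * norm (z - z') * norm ?d"
    using a by (simp add: field_simps norm_minus_commute)
  then show ?thesis
    using a by (cases "norm ?d = 0") (auto simp: power2_eq_square mult_le_cancel_right)
qed

lemma continuous_on_prox:
  assumes "a > 0"
  shows "continuous_on UNIV (prox a)"
proof -
  have "a-lipschitz_on UNIV (prox a)"
    using assms prox_lipschitz[OF assms] by (intro lipschitz_onI) (auto simp: dist_norm)
  then show ?thesis by (rule lipschitz_on_continuous_on)
qed

text \<open>In \<open>z\<close> the value is concave with gradient \<open>prox a z\<close>; this is
  its smoothness inequality. By Young's inequality the growth term absorbs the move from
  \<open>prox a z\<close> to \<open>prox a (z + g)\<close>.\<close>

lemma prox_val_step:
  assumes a: "a > 0"
  shows "g \<bullet> prox a z \<le> prox_val X psi a (z + g) - prox_val X psi a z + a / 2 * (norm g)\<^sup>2"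
proof -
  let ?d = "prox a z - prox a (z + g)"
  have "prox_val X psi a z + 1 / (2 * a) * (norm ?d)\<^sup>2
      \<le> prox_val X psi a (z + g) - g \<bullet> prox a (z + g)"
    using prox_val_growth[OF a, of z "z + g"] by (simp add: norm_minus_commute)
  moreover have "g \<bullet> ?d \<le> a / 2 * (norm g)\<^sup>2 + 1 / (2 * a) * (norm ?d)\<^sup>2"
  proof -
    have "g \<bullet> ?d \<le> norm g * norm ?d" by (rule norm_cauchy_schwarz)
    also have "\<dots> \<le> a / 2 * (norm g)\<^sup>2 + 1 / (2 * a) * (norm ?d)\<^sup>2"
    proof -
      have "0 \<le> (a * norm g - norm ?d)\<^sup>2 / (2 * a)" using a by simp
      then show ?thesis using a by (simp add: power2_diff field_simps power2_eq_square)
    qed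
    finally show ?thesis .
  qed
  ultimately show ?thesis by (simp add: inner_diff_right)
qed

text \<open>The regularised values telescope: since \<open>a\<close> decreases, passing from
  \<open>a t\<close> to \<open>a (Suc t)\<close> can only raise the value, and the last value is
  compared with the objective at \<open>v\<close>.\<close>

lemma dual_averaging:
  assumes a: "\<And>t. a t > 0" "\<And>t. a (Suc t) \<le> a t"
    and z: "z 0 = 0" "\<And>t. z (Suc t) = z t + g t"
    and v: "v \<in> X" and d: "\<And>x. x \<in> X \<Longrightarrow> norm (v - x) \<le> d"
  shows "(\<Sum>t<T. g (Suc t) \<bullet> (prox (a t) (z (Suc t)) - v))
    \<le> norm (g 0) * d + 1 / a T * psi v + (\<Sum>t<T. a t / 2 * (norm (g (Suc t)))\<^sup>2)"
proof -
  let ?V = "\<lambda>t. prox_val X psi (a t) (z (Suc t))"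
  have "g (Suc t) \<bullet> prox (a t) (z (Suc t)) \<le> ?V (Suc t) - ?V t + a t / 2 * (norm (g (Suc t)))\<^sup>2" for t
    using prox_val_step[OF a(1), of "g (Suc t)" t "z (Suc t)"]
      prox_val_antimono[OF a(1) a(2), of t "z (Suc (Suc t))"] z(2) by fastforce
  then have "(\<Sum>t<T. g (Suc t) \<bullet> prox (a t) (z (Suc t)))
      \<le> (\<Sum>t<T. ?V (Suc t) - ?V t + a t / 2 * (norm (g (Suc t)))\<^sup>2)"
    by (intro sum_mono)
  also have "\<dots> = ?V T - ?V 0 + (\<Sum>t<T. a t / 2 * (norm (g (Suc t)))\<^sup>2)"
    using sum_lessThan_telescope[of ?V T] by (simp add: sum.distrib)
  finally have 1: "(\<Sum>t<T. g (Suc t) \<bullet> prox (a t) (z (Suc t))) \<le> \<dots>" .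
  have 2: "?V T \<le> z (Suc T) \<bullet> v + 1 / a T * psi v"
    by (rule prox_val_le[OF a(1) v])
  have zsum: "z t = (\<Sum>s<t. g s)" for t
    by (induction t) (auto simp: z)
  have 3: "z (Suc T) \<bullet> v = g 0 \<bullet> v + (\<Sum>t<T. g (Suc t) \<bullet> v)"
    unfolding zsum sum.lessThan_Suc_shift by (simp add: inner_sum_left inner_left_distrib)
  \<comment> \<open>\<open>z (Suc 0)\<close> is already \<open>g 0\<close>. Its part
    \<open>g 0 \<bullet> v\<close> cancels against the same term of
    \<open>z (Suc T) \<bullet> v\<close>, and \<open>norm (g 0) * d\<close> remains.\<close>
  have 4: "g 0 \<bullet> v - norm (g 0) * d \<le> ?V 0"
  proof (rule prox_val_ge)
    fix x assume x: "x \<in> X"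
    have "g 0 \<bullet> (v - x) \<le> norm (g 0) * norm (v - x)" by (rule norm_cauchy_schwarz)
    also have "\<dots> \<le> norm (g 0) * d" using d[OF x] by (simp add: mult_left_mono)
    finally show "g 0 \<bullet> v - norm (g 0) * d \<le> z (Suc 0) \<bullet> x + 1 / a 0 * psi x"
      using psi_nonneg[OF x] a(1)[of 0] z
      by (smt (verit) add.left_neutral divide_nonneg_pos inner_diff_right mult_nonneg_nonneg)
  qed
  show ?thesis using 1 2 3 4 by (simp add: inner_diff_right sum_subtractf)
qed

end

text \<open>At an attained minimiser the value gap is 0, so quadratic growth forces it onto the
  limit point. Thus the relational updates of the nodes inherit the Lipschitz bound of
  \<open>prox\<close>.\<close>

lemma is_prox_eq_prox:
  fixes X :: "(real ^ 'n) set"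
  assumes "prox_function X psi" "a > 0" "is_prox X psi z a v"
  shows "v = prox_function.prox X psi a z"
proof -
  interpret prox_function X psi by fact
  have v: "v \<in> X" "\<And>x. x \<in> X \<Longrightarrow> z \<bullet> v + 1 / a * psi v \<le> z \<bullet> x + 1 / a * psi x"
    using assms(3) unfolding is_prox_def is_arg_min_def by (auto simp: not_less)
  then have "prox_val X psi a z = z \<bullet> v + 1 / a * psi v"
    using prox_val_le[OF assms(2) v(1)] prox_val_ge[OF v(2)] by (intro antisym) auto
  moreover obtain s where "prox_limit a z s (prox a z)" using prox(2)[OF assms(2)] by blast
  ultimately have "1 / (2 * a) * (norm (v - prox a z))\<^sup>2 \<le> 0"
    using prox_limit_growth[OF assms(2) _ v(1)] by fastforce
  then have "norm (v - prox a z) = 0"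
    using assms(2) by (simp add: divide_le_0_iff)
  then show ?thesis by simp
qed

section \<open>Products of column-stochastic matrices\<close>

definition col_stochastic :: "real ^ 'n ^ 'n \<Rightarrow> bool" where
  "col_stochastic A \<longleftrightarrow> (\<forall>i j. 0 \<le> A $ i $ j) \<and> (\<forall>j. (\<Sum>i\<in>UNIV. A $ i $ j) = 1)"

lemma weight_mat_nth:
  "weight_mat E $ i $ j = (if (j, i) \<in> E \<or> i = j then 1 / real (out_deg E j) else 0)"
  by (auto simp: weight_mat_def in_nbrs_def)

lemma out_deg_bounds:
  fixes E :: "('n::finite \<times> 'n) set"
  shows "0 < out_deg E j" "out_deg E j \<le> CARD('n)"
  unfolding out_deg_def by (auto simp: card_gt_0_iff intro!: card_mono)

lemma col_stochastic_weight_mat: "col_stochastic (weight_mat E)"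
  unfolding col_stochastic_def
proof (intro conjI allI)
  fix j
  have "(\<Sum>i\<in>UNIV. weight_mat E $ i $ j) = (\<Sum>i\<in>{l. (j, l) \<in> E} \<union> {j}. 1 / real (out_deg E j))"
    unfolding weight_mat_nth by (rule sum.mono_neutral_cong_right) auto
  also have "\<dots> = 1"
    using out_deg_bounds(1)[of E j] by (simp add: out_deg_def)
  finally show "(\<Sum>i\<in>UNIV. weight_mat E $ i $ j) = 1" .
qed (simp add: weight_mat_nth)

lemma weight_mat_ge:
  fixes E :: "('n::finite \<times> 'n) set"
  assumes "(j, i) \<in> E \<or> i = j"
  shows "1 / real CARD('n) \<le> weight_mat E $ i $ j"
  using out_deg_bounds[of E j] assms by (simp add: weight_mat_nth frac_le)

lemma col_stochastic_mat_1: "col_stochastic (mat 1)"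
  by (simp add: col_stochastic_def mat_def)

lemma col_stochastic_mult:
  assumes "col_stochastic A" "col_stochastic B"
  shows "col_stochastic (A ** B)"
  unfolding col_stochastic_def
proof (intro conjI allI)
  fix i j show "0 \<le> (A ** B) $ i $ j"
    using assms by (auto simp: col_stochastic_def matrix_matrix_mult_def intro!: sum_nonneg)
next
  fix j
  have "(\<Sum>i\<in>UNIV. (A ** B) $ i $ j) = (\<Sum>k\<in>UNIV. (\<Sum>i\<in>UNIV. A $ i $ k) * B $ k $ j)"
    unfolding sum_distrib_right by (simp add: matrix_matrix_mult_def, rule sum.swap)
  also have "\<dots> = 1" using assms by (simp add: col_stochastic_def)
  finally show "(\<Sum>i\<in>UNIV. (A ** B) $ i $ j) = 1" .
qed

text \<open>Mixing conserves the total over the nodes; this is why the averages obey a recursion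
  without the matrices.\<close>

lemma sum_rows_col_stochastic_mult:
  fixes P :: "real ^ 'm ^ 'm" and Q :: "real ^ 'n ^ 'm"
  assumes "col_stochastic P"
  shows "(\<Sum>j\<in>UNIV. (P ** Q) $ j) = (\<Sum>j\<in>UNIV. Q $ j)"
proof -
  have "(\<Sum>j\<in>UNIV. (P ** Q) $ j $ k) = (\<Sum>j\<in>UNIV. Q $ j $ k)" for k
  proof -
    have "(\<Sum>j\<in>UNIV. (P ** Q) $ j $ k) = (\<Sum>l\<in>UNIV. (\<Sum>j\<in>UNIV. P $ j $ l) * Q $ l $ k)"
      unfolding sum_distrib_right by (simp add: matrix_matrix_mult_def, rule sum.swap)
    then show ?thesis using assms by (simp add: col_stochastic_def)
  qed
  then show ?thesis by (simp add: vec_eq_iff)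
qed

text \<open>Noise is added before mixing and enters through \<open>A t ** eta t\<close>; this bound
  lets the raw noise measure its size.\<close>

lemma sum_abs_col_stochastic_mult_le:
  fixes P :: "real ^ 'm ^ 'm" and Q :: "real ^ 'n ^ 'm"
  assumes "col_stochastic P"
  shows "(\<Sum>j\<in>UNIV. \<Sum>k\<in>UNIV. \<bar>(P ** Q) $ j $ k\<bar>) \<le> (\<Sum>j\<in>UNIV. \<Sum>k\<in>UNIV. \<bar>Q $ j $ k\<bar>)"
proof -
  have P: "0 \<le> P $ j $ l" "(\<Sum>j\<in>UNIV. P $ j $ l) = 1" for j l
    using assms by (auto simp: col_stochastic_def)
  have "\<bar>(P ** Q) $ j $ k\<bar> \<le> (\<Sum>l\<in>UNIV. P $ j $ l * \<bar>Q $ l $ k\<bar>)" for j k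
    using sum_abs[of "\<lambda>l. P $ j $ l * Q $ l $ k" UNIV] P(1)
    by (simp add: matrix_matrix_mult_def abs_mult)
  then have "(\<Sum>j\<in>UNIV. \<Sum>k\<in>UNIV. \<bar>(P ** Q) $ j $ k\<bar>)
      \<le> (\<Sum>j\<in>UNIV. \<Sum>k\<in>UNIV. \<Sum>l\<in>UNIV. P $ j $ l * \<bar>Q $ l $ k\<bar>)"
    by (intro sum_mono)
  also have "\<dots> = (\<Sum>j\<in>UNIV. \<Sum>l\<in>UNIV. P $ j $ l * (\<Sum>k\<in>UNIV. \<bar>Q $ l $ k\<bar>))"
    unfolding sum_distrib_left by (intro sum.cong refl sum.swap)
  also have "\<dots> = (\<Sum>l\<in>UNIV. (\<Sum>j\<in>UNIV. P $ j $ l) * (\<Sum>k\<in>UNIV. \<bar>Q $ l $ k\<bar>))"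
    unfolding sum_distrib_right by (rule sum.swap)
  finally show ?thesis using P(2) by simp
qed

text \<open>Counting factors from the starting index admits the empty product and makes splitting a
  product an identity in the lengths; \<open>mat_prod\<close> always has at least one
  factor.\<close>

primrec step_prod :: "(nat \<Rightarrow> real ^ 'n ^ 'n) \<Rightarrow> nat \<Rightarrow> nat \<Rightarrow> real ^ 'n ^ 'n" where
  "step_prod A s 0 = mat 1"
| "step_prod A s (Suc m) = A (s + m) ** step_prod A s m"

lemma mat_prod_eq_step_prod: "mat_prod A t 0 = step_prod A 0 (Suc t)"
  by (induction t) simp_all

lemma step_prod_add: "step_prod A s (m + l) = step_prod A (s + m) l ** step_prod A s m"
  by (induction l) (simp_all add: matrix_mul_assoc add.assoc)

lemma col_stochastic_step_prod:
  assumes "\<And>t. col_stochastic (A t)"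
  shows "col_stochastic (step_prod A s m)"
  by (induction m) (simp_all add: col_stochastic_mat_1 col_stochastic_mult assms)

text \<open>Each entry of row \<open>i\<close> of the product is a convex combination of the entries
  of row \<open>i\<close> of \<open>A\<close>.\<close>

lemma matrix_mult_ge:
  assumes "\<And>k. c \<le> A $ i $ k" "col_stochastic B"
  shows "c \<le> (A ** B) $ i $ j"
proof -
  have "c = (\<Sum>k\<in>UNIV. c * B $ k $ j)"
    using assms(2) by (simp add: col_stochastic_def flip: sum_distrib_left)
  also have "\<dots> \<le> (\<Sum>k\<in>UNIV. A $ i $ k * B $ k $ j)"
    using assms by (intro sum_mono mult_right_mono) (auto simp: col_stochastic_def)
  finally show ?thesis by (simp add: matrix_matrix_mult_def)
qed

lemma matrix_mult_ge':
  assumes "col_stochastic A" "col_stochastic B" "0 \<le> a" "a \<le> A $ i $ k" "b \<le> B $ k $ j" "0 \<le> b"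
  shows "a * b \<le> (A ** B) $ i $ j"
proof -
  have "a * b \<le> A $ i $ k * B $ k $ j" using assms by (intro mult_mono) auto
  also have "\<dots> \<le> (\<Sum>k\<in>UNIV. A $ i $ k * B $ k $ j)"
    using assms(1,2) by (intro member_le_sum) (auto simp: col_stochastic_def)
  finally show ?thesis by (simp add: matrix_matrix_mult_def)
qed

definition osc_le :: "real ^ 'n \<Rightarrow> real \<Rightarrow> bool" where
  "osc_le r c \<longleftrightarrow> (\<forall>j k. r $ j - r $ k \<le> c)"

text \<open>Dobrushin's contraction: any two columns share the mass \<open>\<delta>\<close> in every row.\<close>

lemma osc_le_vector_matrix_mult:
  fixes r :: "real ^ 'n"
  assumes A: "col_stochastic A" "\<And>i j. \<delta> \<le> A $ i $ j" and r: "osc_le r c"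
  shows "osc_le (r v* A) ((1 - real CARD('n) * \<delta>) * c)"
  unfolding osc_le_def
proof (intro allI)
  fix j k
  let ?\<kappa> = "1 - real CARD('n) * \<delta>"
  have mass: "(\<Sum>i\<in>UNIV. A $ i $ l - \<delta>) = ?\<kappa>" for l
    using A(1) by (simp add: col_stochastic_def sum_subtractf)
  have "?\<kappa> = (\<Sum>i\<in>UNIV. A $ i $ j - \<delta>)" by (simp add: mass)
  also have "\<dots> \<ge> 0" using A(2) by (intro sum_nonneg) simp
  finally have \<kappa>: "?\<kappa> \<ge> 0" .
  have "Max (range (($) r)) \<in> range (($) r)" "Min (range (($) r)) \<in> range (($) r)"
    by (intro Max_in Min_in; simp)+
  then obtain p q where p: "Max (range (($) r)) = r $ p" and q: "Min (range (($) r)) = r $ q"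
    by fastforce
  have rp: "r $ i \<le> r $ p" for i unfolding p[symmetric] by (rule Max_ge) auto
  have rq: "r $ q \<le> r $ i" for i unfolding q[symmetric] by (rule Min_le) auto
  have "(r v* A) $ j - (r v* A) $ k
      = (\<Sum>i\<in>UNIV. (A $ i $ j - \<delta>) * r $ i) - (\<Sum>i\<in>UNIV. (A $ i $ k - \<delta>) * r $ i)"
    by (simp add: vector_matrix_mult_def algebra_simps sum_subtractf)
  also have "\<dots> \<le> (\<Sum>i\<in>UNIV. (A $ i $ j - \<delta>) * r $ p) - (\<Sum>i\<in>UNIV. (A $ i $ k - \<delta>) * r $ q)"
    using A(2) rp rq by (intro diff_mono sum_mono mult_left_mono) auto
  finally have "(r v* A) $ j - (r v* A) $ k \<le> ?\<kappa> * (r $ p - r $ q)"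
    by (simp add: mass right_diff_distrib flip: sum_distrib_right)
  also have "\<dots> \<le> ?\<kappa> * c"
    using r \<kappa> by (intro mult_left_mono) (auto simp: osc_le_def)
  finally show "(r v* A) $ j - (r v* A) $ k \<le> ?\<kappa> * c" .
qed

lemma matrix_mult_nth: "(A ** B) $ i = (A $ i) v* B"
  for A :: "real ^ 'm ^ 'l" and B :: "real ^ 'n ^ 'm"
  by (simp add: vec_eq_iff matrix_matrix_mult_def vector_matrix_mult_def mult.commute)

text \<open>The exponent is constant on blocks of \<open>N\<close> consecutive indices, so the sum
  is at most \<open>N\<close> copies of a geometric series.\<close>

lemma sum_power_div_le:
  fixes q :: real
  assumes "0 \<le> q" "q < 1" "0 < N"
  shows "(\<Sum>m<t. q ^ (m div N)) \<le> real N / (1 - q)"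
proof -
  have "(\<Sum>m<t. q ^ (m div N)) \<le> (\<Sum>m<t * N. q ^ (m div N))"
    using assms by (intro sum_mono2) auto
  also have "\<dots> = (\<Sum>k<t. \<Sum>m\<in>{k * N..<k * N + N}. q ^ (m div N))"
    by (rule sum.nat_group[symmetric])
  also have "\<dots> = (\<Sum>k<t. \<Sum>m\<in>{k * N..<k * N + N}. q ^ k)"
  proof (intro sum.cong refl)
    fix k m assume "m \<in> {k * N..<k * N + N}"
    then have "m div N = k" by (intro div_nat_eqI) (auto simp: mult.commute)
    then show "q ^ (m div N) = q ^ k" by simp
  qed
  also have "\<dots> = real N * (\<Sum>k<t. q ^ k)" by (simp add: sum_distrib_left)
  also have "(\<Sum>k<t. q ^ k) \<le> 1 / (1 - q)"
    using assms sum_le_suminf[OF summable_geometric, of q "{..<t}"] by (simp add: suminf_geometric)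
  finally show ?thesis using assms by (simp add: mult_left_mono)
qed

lemma matrix_mult_sum_right: "A ** (\<Sum>s\<in>S. f s) = (\<Sum>s\<in>S. A ** f s)"
  for A :: "real ^ 'm ^ 'l" and f :: "'a \<Rightarrow> real ^ 'n ^ 'm"
proof (induction S rule: infinite_finite_induct)
  case (insert x S)
  then show ?case by (simp add: matrix_add_ldistrib)
qed (simp_all add: matrix_matrix_mult_def vec_eq_iff)

section \<open>Contraction over a strongly connected network\<close>

text \<open>The Dobrushin factor for the entry bound \<open>1 / n ^ ((n - 1) * B)\<close>: each of
  the \<open>n\<close> rows contributes that amount of shared mass.\<close>

definition mixing_rate :: "nat \<Rightarrow> nat \<Rightarrow> real" where
  "mixing_rate n B = 1 - real n * (1 / real n ^ ((n - 1) * B))"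

locale connected_network =
  fixes B :: nat and E :: "nat \<Rightarrow> ('n::finite \<times> 'n) set"
  assumes connected: "B_strongly_connected B E"
begin

abbreviation A :: "nat \<Rightarrow> real ^ 'n ^ 'n" where
  "A t \<equiv> weight_mat (E t)"

lemma B_pos: "0 < B"
  using connected by (simp add: B_strongly_connected_def)

lemma col_stochastic_prod: "col_stochastic (step_prod A s m)"
  by (rule col_stochastic_step_prod) (rule col_stochastic_weight_mat)

text \<open>Reachability with a quantitative threshold: one step along an edge or a self-loop costs
  a factor of at most \<open>n\<close>, since no out-degree exceeds \<open>n\<close>.\<close>

definition reach :: "nat \<Rightarrow> nat \<Rightarrow> 'n \<Rightarrow> 'n set" where
  "reach s m j = {i. 1 / real CARD('n) ^ m \<le> step_prod A s m $ i $ j}"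

lemma reach_self: "j \<in> reach s 0 j"
  by (simp add: reach_def mat_def)

lemma reach_Suc:
  assumes "a \<in> reach s m j" "(a, b) \<in> E (s + m) \<or> b = a"
  shows "b \<in> reach s (Suc m) j"
proof -
  have "1 / real CARD('n) * (1 / real CARD('n) ^ m) \<le> (A (s + m) ** step_prod A s m) $ b $ j"
    using assms weight_mat_ge[of a b "E (s + m)"]
    by (intro matrix_mult_ge'[where k = a] col_stochastic_prod col_stochastic_weight_mat)
      (auto simp: reach_def)
  then show ?thesis by (simp add: reach_def)
qed

lemma reach_mono:
  assumes "m \<le> m'"
  shows "reach s m j \<subseteq> reach s m' j"
  using assms by (induction rule: dec_induct) (auto intro: reach_Suc)

text \<open>If a whole window adds no node, then every edge of the window that starts in the set
  also ends in it, whatever its time within the window. Strong connectivity of the union then leaves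
  no node outside.\<close>

lemma reach_window:
  assumes "s + p = k * B + 1" "reach s (p + B) j = reach s p j"
  shows "reach s p j = UNIV"
proof -
  let ?U = "\<Union>r\<in>{(Suc k - 1) * B + 1..Suc k * B}. E r"
  have step: "b \<in> reach s p j" if "a \<in> reach s p j" "(a, b) \<in> ?U" for a b
  proof -
    from that(2) obtain r where r: "r \<in> {k * B + 1..k * B + B}" "(a, b) \<in> E r"
      by (auto simp: add.commute)
    define l where "l = r - (k * B + 1)"
    have l: "r = s + (p + l)" "Suc (p + l) \<le> p + B"
      using r(1) assms(1) by (auto simp: l_def)
    have "a \<in> reach s (p + l) j" using that(1) reach_mono[of p "p + l"] by auto
    then have "b \<in> reach s (Suc (p + l)) j" using r(2) l(1) by (auto intro: reach_Suc)
    then show ?thesis using reach_mono[OF l(2)] assms(2) by blast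
  qed
  have closed: "b \<in> reach s p j" if "(a, b) \<in> ?U\<^sup>*" "a \<in> reach s p j" for a b
    using that by (induction rule: rtrancl_induct) (use step in blast)+
  have "j \<in> reach s p j" using reach_self[of j s] reach_mono[of 0 p s j] by auto
  moreover have "(j, b) \<in> ?U\<^sup>*" for b
    using connected unfolding B_strongly_connected_def by (metis le_add1 plus_1_eq_Suc)
  ultimately show ?thesis using closed by blast
qed

text \<open>By the dichotomy of \<open>reach_window\<close>, each aligned window either adds a node
  or finds the set full.\<close>

lemma card_reach:
  assumes "s + p = k * B + 1"
  shows "min CARD('n) (l + 1) \<le> card (reach s (p + l * B) j)"
proof (induction l)
  case 0
  have "j \<in> reach s p j" using reach_self[of j s] reach_mono[of 0 p s j] by auto
  then have "0 < card (reach s p j)" by (auto simp: card_gt_0_iff)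
  then show ?case by simp
next
  case (Suc l)
  let ?R = "reach s (p + l * B) j" and ?R' = "reach s (p + l * B + B) j"
  have sub: "?R \<subseteq> ?R'" by (rule reach_mono) simp
  have eq: "reach s (p + Suc l * B) j = ?R'" by (simp add: add_ac)
  show ?case
  proof (cases "?R' = ?R")
    case True
    moreover have "s + (p + l * B) = (k + l) * B + 1"
      using assms by (simp add: algebra_simps)
    ultimately have "?R = UNIV" by (intro reach_window)
    then show ?thesis using True eq by simp
  next
    case False
    then have "card ?R < card ?R'" using sub by (intro psubset_card_mono) auto
    then show ?thesis using Suc eq by simp
  qed
qed

lemma reach_all:
  assumes "s + p = k * B + 1"
  shows "reach s (p + (CARD('n) - 1) * B) j = UNIV"
proof -
  have "CARD('n) \<le> card (reach s (p + (CARD('n) - 1) * B) j)"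
    using card_reach[OF assms, of "CARD('n) - 1" j] zero_less_card_finite by simp
  then show ?thesis
    by (intro card_seteq) auto
qed

lemma aligned: obtains p k where "s + p = k * B + 1" "p \<le> B"
proof
  \<comment> \<open>The quotient \<open>(s + B - 1) div B\<close> is \<open>s / B\<close> rounded
    up, so its multiple by \<open>B\<close> is at least \<open>s\<close>. The truncated subtraction
    is therefore exact, and the shift lies between 1 and \<open>B\<close>.\<close>
  define m where "m = (s + B - 1) mod B"
  have eq: "(s + B - 1) div B * B + m = s + B - 1" unfolding m_def by (rule div_mult_mod_eq)
  have m: "m < B" using B_pos by (simp add: m_def)
  show "s + ((s + B - 1) div B * B + 1 - s) = (s + B - 1) div B * B + 1"
    using eq m B_pos by linarith
  show "(s + B - 1) div B * B + 1 - s \<le> B" using eq m B_pos by linarith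
qed

lemma aligned_le: "p \<le> B \<Longrightarrow> p + (CARD('n) - 1) * B \<le> CARD('n) * B"
  using zero_less_card_finite by (simp add: algebra_simps diff_mult_distrib)

lemma step_prod_full_ge: "1 / real CARD('n) ^ (CARD('n) * B) \<le> step_prod A s (CARD('n) * B) $ i $ j"
proof -
  obtain p k where p: "s + p = k * B + 1" "p \<le> B" by (rule aligned)
  have "reach s (CARD('n) * B) j = UNIV"
    using reach_all[OF p(1), of j] reach_mono[OF aligned_le[OF p(2)], of s j] by auto
  then show ?thesis by (auto simp: reach_def)
qed

lemma mixing_rate_nonneg:
  assumes "2 \<le> CARD('n)"
  shows "0 \<le> mixing_rate CARD('n) B"
proof -
  have "(CARD('n) - 1) * B \<ge> 1" using assms B_pos by simp
  then have "real CARD('n) ^ 1 \<le> real CARD('n) ^ ((CARD('n) - 1) * B)"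
    using zero_less_card_finite by (intro power_increasing) auto
  then show ?thesis using zero_less_card_finite by (simp add: mixing_rate_def)
qed

lemma mixing_rate_less_1: "mixing_rate CARD('n) B < 1"
  by (simp add: mixing_rate_def)

text \<open>Only the middle \<open>n - 1\<close> windows contract; the alignment steps before them
  and the remaining \<open>l\<close> steps after them are handled with \<open>\<delta> = 0\<close>,
  which does not enlarge the oscillation. Isolating the middle keeps the exponent at
  \<open>(n - 1) * B\<close> instead of \<open>n * B\<close>.\<close>

lemma osc_le_full:
  assumes "osc_le r c"
  shows "osc_le (r v* step_prod A s (CARD('n) * B)) (mixing_rate CARD('n) B * c)"
proof -
  obtain p k where p: "s + p = k * B + 1" "p \<le> B" by (rule aligned)
  let ?Q = "step_prod A (s + p) ((CARD('n) - 1) * B)"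
  define l where "l = CARD('n) * B - (p + (CARD('n) - 1) * B)"
  have l: "CARD('n) * B = p + ((CARD('n) - 1) * B + l)" using aligned_le[OF p(2)] by (simp add: l_def)
  have "1 / real CARD('n) ^ ((CARD('n) - 1) * B) \<le> ?Q $ i $ j" for i j
    using reach_all[of "s + p" 0 k j] p(1) by (auto simp: reach_def)
  moreover have "osc_le (r v* step_prod A (s + p + (CARD('n) - 1) * B) l) c"
    using osc_le_vector_matrix_mult[OF col_stochastic_prod _ assms, of 0] col_stochastic_prod
    by (simp add: col_stochastic_def)
  ultimately have "osc_le ((r v* step_prod A (s + p + (CARD('n) - 1) * B) l) v* ?Q) (mixing_rate CARD('n) B * c)"
    unfolding mixing_rate_def by (intro osc_le_vector_matrix_mult col_stochastic_prod)
  then have "osc_le (((r v* step_prod A (s + p + (CARD('n) - 1) * B) l) v* ?Q) v* step_prod A s p) (mixing_rate CARD('n) B * c)"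
    using osc_le_vector_matrix_mult[OF col_stochastic_prod, of 0] col_stochastic_prod
    by (fastforce simp: col_stochastic_def)
  then show ?thesis
    unfolding l step_prod_add by (simp add: vector_matrix_mul_assoc matrix_mul_assoc)
qed

lemma osc_le_step_prod: "osc_le (step_prod A s m $ i) (mixing_rate CARD('n) B ^ (m div (CARD('n) * B)))"
proof (induction m arbitrary: s rule: less_induct)
  case (less m)
  have NB: "0 < CARD('n) * B" using B_pos zero_less_card_finite by simp
  show ?case
  proof (cases "m < CARD('n) * B")
    case True
    have "step_prod A s m $ i $ j - step_prod A s m $ i $ k \<le> 1" for j k
    proof -
      have "step_prod A s m $ i $ j \<le> (\<Sum>i\<in>UNIV. step_prod A s m $ i $ j)"
        using col_stochastic_prod by (intro member_le_sum) (auto simp: col_stochastic_def)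
      moreover have "(\<Sum>i\<in>UNIV. step_prod A s m $ i $ j) = 1" "0 \<le> step_prod A s m $ i $ k"
        using col_stochastic_prod[of s m] by (simp_all add: col_stochastic_def)
      ultimately show ?thesis by linarith
    qed
    then show ?thesis using True by (simp add: osc_le_def)
  next
    case False
    then obtain l where l: "m = CARD('n) * B + l" using le_Suc_ex not_less by blast
    have "osc_le (step_prod A (s + CARD('n) * B) l $ i) (mixing_rate CARD('n) B ^ (l div (CARD('n) * B)))"
      using NB by (intro less) (simp add: l)
    then have "osc_le (step_prod A (s + CARD('n) * B) l $ i v* step_prod A s (CARD('n) * B))
        (mixing_rate CARD('n) B * mixing_rate CARD('n) B ^ (l div (CARD('n) * B)))"
      by (rule osc_le_full)
    moreover have "m div (CARD('n) * B) = Suc (l div (CARD('n) * B))" using NB by (simp add: l)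
    ultimately show ?thesis by (simp add: l step_prod_add matrix_mult_nth)
  qed
qed

section \<open>Push-sum weights\<close>

definition weight :: "nat \<Rightarrow> real ^ 'n" where
  "weight t = step_prod A 0 t *v 1"

lemma weight_0: "weight 0 = 1"
  by (simp add: weight_def)

lemma weight_Suc: "weight (Suc t) = A t *v weight t"
  by (simp add: weight_def matrix_vector_mul_assoc)

lemma weight_nth: "weight t $ i = (\<Sum>j\<in>UNIV. step_prod A 0 t $ i $ j)"
  by (simp add: weight_def matrix_vector_mult_def)

lemma weight_nonneg: "0 \<le> weight t $ i"
  using col_stochastic_prod[of 0 t] by (auto simp: weight_nth col_stochastic_def intro: sum_nonneg)

lemma sum_weight: "(\<Sum>i\<in>UNIV. weight t $ i) = real CARD('n)"
proof -
  have "(\<Sum>i\<in>UNIV. weight t $ i) = (\<Sum>j\<in>UNIV. \<Sum>i\<in>UNIV. step_prod A 0 t $ i $ j)"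
    unfolding weight_nth by (rule sum.swap)
  then show ?thesis using col_stochastic_prod[of 0 t] by (simp add: col_stochastic_def)
qed

text \<open>Short products keep mass on the diagonal through the self-loops. For long ones the last
  \<open>n * B\<close> factors have all entries bounded below, and multiplying on the right by the
  earlier factors only takes convex combinations.\<close>

lemma weight_ge: "1 / real CARD('n) ^ (CARD('n) * B) \<le> weight t $ i"
proof -
  have nn: "0 \<le> step_prod A 0 t $ i $ j" for j
    using col_stochastic_prod[of 0 t] by (simp add: col_stochastic_def)
  have "1 / real CARD('n) ^ (CARD('n) * B) \<le> step_prod A 0 t $ i $ i"
  proof (cases "t < CARD('n) * B")
    case True
    have "i \<in> reach 0 t i" using reach_self[of i 0] reach_mono[of 0 t 0 i] by auto
    then have "1 / real CARD('n) ^ t \<le> step_prod A 0 t $ i $ i" by (simp add: reach_def)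
    moreover have "1 / real CARD('n) ^ (CARD('n) * B) \<le> 1 / real CARD('n) ^ t"
      using True zero_less_card_finite by (intro divide_left_mono power_increasing) auto
    ultimately show ?thesis by simp
  next
    case False
    define l where "l = t - CARD('n) * B"
    have t: "t = l + CARD('n) * B" using False by (simp add: l_def)
    show ?thesis unfolding t step_prod_add
      by (intro matrix_mult_ge step_prod_full_ge col_stochastic_prod)
  qed
  also have "\<dots> \<le> weight t $ i"
    unfolding weight_nth using nn by (intro member_le_sum) auto
  finally show ?thesis .
qed

text \<open>Since \<open>weight t\<close> is the product applied to \<open>weight s\<close>, whose
  entries are nonnegative with total \<open>n\<close>, the number \<open>weight t $ i / n\<close> is
  a convex combination of row \<open>i\<close>. An entry is within the oscillation of any such
  combination.\<close>

lemma step_prod_minus_weight: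
  assumes "s \<le> t"
  shows "\<bar>step_prod A s (t - s) $ i $ j - weight t $ i / real CARD('n)\<bar> \<le> mixing_rate CARD('n) B ^ ((t - s) div (CARD('n) * B))"
proof -
  let ?P = "step_prod A s (t - s)" and ?\<rho> = "mixing_rate CARD('n) B ^ ((t - s) div (CARD('n) * B))"
  have "weight t = ?P *v weight s"
    using step_prod_add[of A 0 s "t - s"] assms by (simp add: weight_def matrix_vector_mul_assoc)
  then have w: "weight t $ i = (\<Sum>k\<in>UNIV. ?P $ i $ k * weight s $ k)"
    by (simp add: matrix_vector_mult_def)
  have "real CARD('n) * ?P $ i $ j - weight t $ i = (\<Sum>k\<in>UNIV. weight s $ k * (?P $ i $ j - ?P $ i $ k))"
    unfolding w sum_weight[of s, symmetric]
    by (simp add: sum_distrib_right right_diff_distrib sum_subtractf mult.commute)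
  also have "\<bar>\<dots>\<bar> \<le> (\<Sum>k\<in>UNIV. weight s $ k * ?\<rho>)"
  proof (rule order_trans[OF sum_abs sum_mono])
    fix k
    have "\<bar>?P $ i $ j - ?P $ i $ k\<bar> \<le> ?\<rho>"
      using osc_le_step_prod[of s "t - s" i] by (auto simp: osc_le_def abs_le_iff)
    then show "\<bar>weight s $ k * (?P $ i $ j - ?P $ i $ k)\<bar> \<le> weight s $ k * ?\<rho>"
      using weight_nonneg[of s k] by (simp add: abs_mult mult_left_mono)
  qed
  also have "\<dots> = real CARD('n) * ?\<rho>" by (simp add: sum_weight flip: sum_distrib_right)
  finally have "\<bar>real CARD('n) * ?P $ i $ j - weight t $ i\<bar> \<le> real CARD('n) * ?\<rho>" .
  moreover have "?P $ i $ j - weight t $ i / real CARD('n) = (real CARD('n) * ?P $ i $ j - weight t $ i) / real CARD('n)"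
    using zero_less_card_finite by (simp add: field_simps)
  ultimately show ?thesis by (simp add: pos_divide_le_eq mult.commute)
qed

text \<open>\<open>mat_prod\<close> at \<open>t\<close> has \<open>t + 1\<close> factors, so
  \<gamma> concerns the weights from time 1 on. It is at most 1 because the weights average to 1,
  and positive because \<open>weight_ge\<close> is uniform in time.\<close>

lemma weight_bounds:
  assumes \<gamma>: "\<gamma> = (INF t. MIN i. (mat_prod A t 0 *v 1) $ i)"
  shows "0 < \<gamma>" "\<gamma> \<le> 1" "\<gamma> \<le> weight (Suc t) $ i"
proof -
  have eq: "\<gamma> = (INF t. Min (range (\<lambda>i. weight (Suc t) $ i)))"
    unfolding \<gamma> mat_prod_eq_step_prod weight_def ..
  have "1 / real CARD('n) ^ (CARD('n) * B) \<le> \<gamma>"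
    unfolding eq by (intro cINF_greatest) (auto simp: weight_ge)
  then show "0 < \<gamma>" by (rule less_le_trans[rotated]) simp
  have le: "\<gamma> \<le> weight (Suc t) $ i" for t i
  proof -
    have "\<gamma> \<le> Min (range (\<lambda>i. weight (Suc t) $ i))"
      unfolding eq by (intro cINF_lower bdd_belowI2[of _ 0]) (auto simp: weight_nonneg)
    also have "\<dots> \<le> weight (Suc t) $ i" by (rule Min_le) auto
    finally show ?thesis .
  qed
  show "\<gamma> \<le> weight (Suc t) $ i" by (rule le)
  have "(\<Sum>i\<in>(UNIV :: 'n set). \<gamma>) \<le> (\<Sum>i\<in>UNIV. weight (Suc 0) $ i)"
    by (intro sum_mono le)
  then have "real CARD('n) * \<gamma> \<le> real CARD('n) * 1" by (simp add: sum_weight)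
  then show "\<gamma> \<le> 1" by (simp only: mult_le_cancel_left_pos of_nat_0_less_iff zero_less_card_finite)
qed

lemma sum_mixing_rate_le:
  assumes "2 \<le> CARD('n)"
  shows "(\<Sum>s<t. mixing_rate CARD('n) B ^ ((t - Suc s) div (CARD('n) * B)))
    \<le> real (CARD('n) * B) / (1 - mixing_rate CARD('n) B)"
proof -
  have "(\<Sum>s<t. mixing_rate CARD('n) B ^ ((t - Suc s) div (CARD('n) * B)))
      = (\<Sum>m<t. mixing_rate CARD('n) B ^ (m div (CARD('n) * B)))"
    by (rule sum.nat_diff_reindex)
  also have "\<dots> \<le> real (CARD('n) * B) / (1 - mixing_rate CARD('n) B)"
    using mixing_rate_nonneg[OF assms] mixing_rate_less_1 B_pos by (intro sum_power_div_le) auto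
  finally show ?thesis .
qed

text \<open>The input \<open>q s\<close> enters at time \<open>s + 1\<close> after the mixing of
  step \<open>s\<close>, so only the \<open>t - Suc s\<close> later factors act on it.\<close>

lemma push_sum_unroll:
  assumes "z 0 = 0" "\<And>t. z (Suc t) = q t + A t ** z t"
  shows "z t = (\<Sum>s<t. step_prod A (Suc s) (t - Suc s) ** q s)"
proof (induction t)
  case (Suc t)
  have "A t ** (\<Sum>s<t. step_prod A (Suc s) (t - Suc s) ** q s)
      = (\<Sum>s<t. A t ** (step_prod A (Suc s) (t - Suc s) ** q s))"
    by (rule matrix_mult_sum_right)
  also have "\<dots> = (\<Sum>s<t. step_prod A (Suc s) (Suc t - Suc s) ** q s)"
  proof (rule sum.cong[OF refl])
    fix s assume "s \<in> {..<t}"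
    then have "Suc t - Suc s = Suc (t - Suc s)" "Suc s + (t - Suc s) = t" by auto
    then show "A t ** (step_prod A (Suc s) (t - Suc s) ** q s)
        = step_prod A (Suc s) (Suc t - Suc s) ** q s"
      by (simp add: matrix_mul_assoc)
  qed
  finally show ?case by (simp add: assms(2) Suc add.commute)
qed (simp add: assms)

text \<open>If every entry in row \<open>i\<close> of each product were
  \<open>weight t $ i / n\<close>, node \<open>i\<close> would hold exactly its weight times the
  average; only the deviations of the entries remain.\<close>

lemma push_sum_consensus:
  assumes "z 0 = 0" "\<And>t. z (Suc t) = q t + A t ** z t"
  shows "norm (z t $ i - weight t $ i *\<^sub>R ((1 / real CARD('n)) *\<^sub>R (\<Sum>s<t. \<Sum>j\<in>UNIV. q s $ j)))
    \<le> (\<Sum>s<t. mixing_rate CARD('n) B ^ ((t - Suc s) div (CARD('n) * B)) * (\<Sum>j\<in>UNIV. norm (q s $ j)))"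
proof -
  let ?c = "\<lambda>s j. step_prod A (Suc s) (t - Suc s) $ i $ j"
  have "z t $ i = (\<Sum>s<t. \<Sum>j\<in>UNIV. ?c s j *\<^sub>R q s $ j)"
    unfolding push_sum_unroll[where z = z and q = q, OF assms] sum_component
    by (simp add: vec_eq_iff matrix_matrix_mult_def)
  moreover have "weight t $ i *\<^sub>R ((1 / real CARD('n)) *\<^sub>R (\<Sum>s<t. \<Sum>j\<in>UNIV. q s $ j))
      = (\<Sum>s<t. \<Sum>j\<in>UNIV. (weight t $ i / real CARD('n)) *\<^sub>R q s $ j)"
    by (simp add: scaleR_sum_right)
  ultimately have "z t $ i - weight t $ i *\<^sub>R ((1 / real CARD('n)) *\<^sub>R (\<Sum>s<t. \<Sum>j\<in>UNIV. q s $ j))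
      = (\<Sum>s<t. \<Sum>j\<in>UNIV. (?c s j - weight t $ i / real CARD('n)) *\<^sub>R q s $ j)"
    by (simp add: sum_subtractf scaleR_left_diff_distrib)
  also have "norm \<dots> \<le> (\<Sum>s<t. \<Sum>j\<in>UNIV. norm ((?c s j - weight t $ i / real CARD('n)) *\<^sub>R q s $ j))"
    by (rule order_trans[OF norm_sum sum_mono[OF norm_sum]])
  also have "\<dots> \<le> (\<Sum>s<t. \<Sum>j\<in>UNIV. mixing_rate CARD('n) B ^ ((t - Suc s) div (CARD('n) * B)) * norm (q s $ j))"
    unfolding norm_scaleR
    by (intro sum_mono mult_right_mono step_prod_minus_weight) auto
  finally show ?thesis by (simp add: sum_distrib_left)
qed

end

section \<open>Moments, measurability and independence\<close>

lemma has_bochner_integral_exponential_moment: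
  fixes l :: real
  assumes "0 < l"
  shows "has_bochner_integral lborel (\<lambda>x. exponential_density l x * x ^ i) (fact i / l ^ i)"
proof (rule has_bochner_integral_nn_integral)
  show "(\<integral>\<^sup>+ x. ennreal (exponential_density l x * x ^ i) \<partial>lborel) = ennreal (fact i / l ^ i)"
    using nn_integral_erlang_ith_moment[OF assms, of 0 i] by simp
qed (use assms in \<open>auto simp: exponential_density_def\<close>)

text \<open>Each half of the Laplace density is half an exponential density of rate
  \<open>1 / s\<close>, so its moments are known; parity then gives the full ones.\<close>

lemma has_bochner_integral_laplace_half_moment:
  fixes s :: real
  assumes "0 < s"
  shows "has_bochner_integral lborel
    (\<lambda>x. indicator {0..} x *\<^sub>R (1 / (2 * s) * exp (- \<bar>x\<bar> / s) * x ^ i)) (fact i * s ^ i / 2)"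
proof -
  have "has_bochner_integral lborel (\<lambda>x. 1 / 2 * (exponential_density (1 / s) x * x ^ i))
      (1 / 2 * (fact i / (1 / s) ^ i))"
    using assms by (intro has_bochner_integral_mult_right has_bochner_integral_exponential_moment) auto
  moreover have "1 / 2 * (exponential_density (1 / s) x * x ^ i)
      = indicator {0..} x *\<^sub>R (1 / (2 * s) * exp (- \<bar>x\<bar> / s) * x ^ i)" for x
    by (auto simp: exponential_density_def indicator_def)
  moreover have "1 / 2 * (fact i / (1 / s) ^ i) = fact i * s ^ i / 2"
    using assms by (simp add: power_one_over)
  ultimately show ?thesis by (simp only:)
qed

lemma laplace_moments:
  assumes N: "laplace_distributed M N s" and "0 \<le> s"
  shows "integrable M N" "integral\<^sup>L M N = 0"
    "integrable M (\<lambda>\<omega>. (N \<omega>)\<^sup>2)" "(\<integral>\<omega>. (N \<omega>)\<^sup>2 \<partial>M) = 2 * s\<^sup>2"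
proof -
  have [measurable]: "N \<in> borel_measurable M"
    using N by (simp add: laplace_distributed_def)
  have "integrable M N \<and> integral\<^sup>L M N = 0 \<and> integrable M (\<lambda>\<omega>. (N \<omega>)\<^sup>2)
    \<and> (\<integral>\<omega>. (N \<omega>)\<^sup>2 \<partial>M) = 2 * s\<^sup>2"
  proof (cases "s = 0")
    case True
    then have 0: "AE \<omega> in M. N \<omega> = 0" using N by (simp add: laplace_distributed_def)
    then have "AE \<omega> in M. (N \<omega>)\<^sup>2 = 0" by eventually_elim simp
    then show ?thesis
      using True 0 integrable_cong_AE[of N M "\<lambda>_. 0"] integral_eq_zero_AE[of N M]
        integrable_cong_AE[of "\<lambda>\<omega>. (N \<omega>)\<^sup>2" M "\<lambda>_. 0"] integral_eq_zero_AE[of "\<lambda>\<omega>. (N \<omega>)\<^sup>2" M]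
      by simp
  next
    case False
    then have s: "0 < s" using assms(2) by simp
    let ?g = "\<lambda>x. 1 / (2 * s) * exp (- \<bar>x\<bar> / s)"
    have D: "distributed M lborel N (\<lambda>x. ennreal (?g x))"
      using N False by (simp add: laplace_distributed_def)
    have 1: "has_bochner_integral lborel (\<lambda>x. ?g x * x ^ 1) 0"
      by (rule has_bochner_integral_odd_function[OF has_bochner_integral_laplace_half_moment[OF s]])
        simp
    have 2: "has_bochner_integral lborel (\<lambda>x. ?g x * x ^ 2) (2 *\<^sub>R (fact 2 * s ^ 2 / 2))"
      by (rule has_bochner_integral_even_function[OF has_bochner_integral_laplace_half_moment[OF s]])
        simp
    have g0: "\<And>x. 0 \<le> ?g x" using s by simp
    have "has_bochner_integral M (\<lambda>\<omega>. N \<omega> ^ 1) 0"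
      using 1 distributed_integrable[OF D, of "\<lambda>x. x ^ 1"] distributed_integral[OF D, of "\<lambda>x. x ^ 1"] g0 False
      by (auto simp: has_bochner_integral_iff)
    moreover have "has_bochner_integral M (\<lambda>\<omega>. N \<omega> ^ 2) (2 *\<^sub>R (fact 2 * s ^ 2 / 2))"
      using 2 distributed_integrable[OF D, of "\<lambda>x. x ^ 2"] distributed_integral[OF D, of "\<lambda>x. x ^ 2"] g0 False
      by (auto simp: has_bochner_integral_iff)
    ultimately show ?thesis by (simp add: has_bochner_integral_iff)
  qed
  then show "integrable M N" "integral\<^sup>L M N = 0"
    "integrable M (\<lambda>\<omega>. (N \<omega>)\<^sup>2)" "(\<integral>\<omega>. (N \<omega>)\<^sup>2 \<partial>M) = 2 * s\<^sup>2" by auto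
qed

text \<open>Nonnegativity of the variance of the absolute value serves as Jensen's
  inequality.\<close>

lemma (in prob_space) expectation_abs_le:
  fixes N :: "'a \<Rightarrow> real"
  assumes [measurable]: "N \<in> borel_measurable M" and int: "integrable M (\<lambda>\<omega>. (N \<omega>)\<^sup>2)"
    and le: "expectation (\<lambda>\<omega>. (N \<omega>)\<^sup>2) \<le> c\<^sup>2" and "0 \<le> c"
  shows "integrable M N" "expectation (\<lambda>\<omega>. \<bar>N \<omega>\<bar>) \<le> c"
proof -
  show N: "integrable M N" by (rule square_integrable_imp_integrable[OF assms(1) int])
  have "variance (\<lambda>\<omega>. \<bar>N \<omega>\<bar>) = expectation (\<lambda>\<omega>. (N \<omega>)\<^sup>2) - (expectation (\<lambda>\<omega>. \<bar>N \<omega>\<bar>))\<^sup>2"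
    using variance_eq[of "\<lambda>\<omega>. \<bar>N \<omega>\<bar>"] N int by simp
  then have "(expectation (\<lambda>\<omega>. \<bar>N \<omega>\<bar>))\<^sup>2 \<le> c\<^sup>2"
    using variance_positive[of "\<lambda>\<omega>. \<bar>N \<omega>\<bar>"] le by simp
  then show "expectation (\<lambda>\<omega>. \<bar>N \<omega>\<bar>) \<le> c" using \<open>0 \<le> c\<close> by (rule power2_le_imp_le)
qed

lemma (in prob_space) expectation_sum_squared_indep:
  fixes N :: "'i \<Rightarrow> 'a \<Rightarrow> real"
  assumes I: "finite I" and indep: "indep_vars (\<lambda>_. borel) N I"
    and int: "\<And>i. i \<in> I \<Longrightarrow> integrable M (N i)"
    and sq: "\<And>i. i \<in> I \<Longrightarrow> integrable M (\<lambda>\<omega>. (N i \<omega>)\<^sup>2)"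
    and mean: "\<And>i. i \<in> I \<Longrightarrow> expectation (N i) = 0"
  shows "integrable M (\<lambda>\<omega>. (\<Sum>i\<in>I. N i \<omega>)\<^sup>2)"
    "expectation (\<lambda>\<omega>. (\<Sum>i\<in>I. N i \<omega>)\<^sup>2) = (\<Sum>i\<in>I. expectation (\<lambda>\<omega>. (N i \<omega>)\<^sup>2))"
proof -
  have expand: "(\<Sum>i\<in>I. N i \<omega>)\<^sup>2 = (\<Sum>i\<in>I. \<Sum>j\<in>I. N i \<omega> * N j \<omega>)" for \<omega>
    by (simp add: power2_eq_square sum_product)
  have "integrable M (\<lambda>\<omega>. N i \<omega> * N j \<omega>) \<and>
      expectation (\<lambda>\<omega>. N i \<omega> * N j \<omega>) = (if i = j then expectation (\<lambda>\<omega>. (N i \<omega>)\<^sup>2) else 0)"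
    if "i \<in> I" "j \<in> I" for i j
  proof (cases "i = j")
    case True
    then show ?thesis using sq[OF that(1)] by (simp add: power2_eq_square)
  next
    case False
    have "indep_vars (\<lambda>_. borel) N {i, j}"
      using that by (intro indep_vars_subset[OF indep]) auto
    then show ?thesis
      using that False int mean indep_vars_integrable[of "{i, j}" N]
        indep_vars_lebesgue_integral[of "{i, j}" N] by auto
  qed
  note prod = this
  show "integrable M (\<lambda>\<omega>. (\<Sum>i\<in>I. N i \<omega>)\<^sup>2)"
    unfolding expand using prod by (intro Bochner_Integration.integrable_sum) blast
  have "expectation (\<lambda>\<omega>. (\<Sum>i\<in>I. N i \<omega>)\<^sup>2)
      = (\<Sum>i\<in>I. \<Sum>j\<in>I. expectation (\<lambda>\<omega>. N i \<omega> * N j \<omega>))"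
    unfolding expand using prod by (simp add: Bochner_Integration.integral_sum)
  also have "\<dots> = (\<Sum>i\<in>I. \<Sum>j\<in>I. if i = j then expectation (\<lambda>\<omega>. (N i \<omega>)\<^sup>2) else 0)"
    using prod by (intro sum.cong) auto
  also have "\<dots> = (\<Sum>i\<in>I. expectation (\<lambda>\<omega>. (N i \<omega>)\<^sup>2))" using I by simp
  finally show "expectation (\<lambda>\<omega>. (\<Sum>i\<in>I. N i \<omega>)\<^sup>2) = \<dots>" .
qed

lemma borel_measurable_of_preimages:
  assumes "preimages M Y \<subseteq> sets F" "space F = space M"
  shows "Y \<in> borel_measurable F"
  using assms by (auto simp: preimages_def measurable_def)

text \<open>Translates independence of two families of events into independence of two variables:
  the events of \<open>N\<close> are preimages under \<open>Y\<close>, and those of \<phi> lie in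
  \<open>F\<close>, hence in \<open>G\<close>.\<close>

lemma (in prob_space) expectation_indep_mult_0:
  fixes N \<phi> :: "'a \<Rightarrow> real"
  assumes F: "subalgebra M F"
    and indep: "indep_set (preimages M Y) G" and G: "sets F \<subseteq> G"
    and g: "g \<in> borel_measurable borel" and N: "N = (\<lambda>\<omega>. g (Y \<omega>))"
    and int: "integrable M N" "expectation N = 0"
    and \<phi>: "\<phi> \<in> borel_measurable F" "integrable M \<phi>"
  shows "integrable M (\<lambda>\<omega>. N \<omega> * \<phi> \<omega>)" "expectation (\<lambda>\<omega>. N \<omega> * \<phi> \<omega>) = 0"
proof -
  have "indep_set (sigma_sets (space M) {N -` A \<inter> space M | A. A \<in> sets borel})
      (sigma_sets (space M) {\<phi> -` A \<inter> space M | A. A \<in> sets borel})"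
  proof -
    have "sigma_sets (space M) {N -` A \<inter> space M | A. A \<in> sets borel} \<subseteq> preimages M Y"
    proof -
      have "{N -` A \<inter> space M | A. A \<in> sets borel} = sets (vimage_algebra (space M) N borel)"
        by (simp add: sets_vimage_algebra2)
      moreover have "sigma_sets (space M) (sets (vimage_algebra (space M) N borel))
          = sets (vimage_algebra (space M) N borel)"
        using sets.sigma_sets_eq[of "vimage_algebra (space M) N borel"] by simp
      moreover have "{N -` A \<inter> space M | A. A \<in> sets borel} \<subseteq> preimages M Y"
        unfolding preimages_def N
      proof clarify
        fix A :: "real set" assume "A \<in> sets borel"
        then have "g -` A \<in> sets borel" using measurable_sets_borel[OF g] by simp
        then show "\<exists>S. (\<lambda>\<omega>. g (Y \<omega>)) -` A \<inter> space M = Y -` S \<inter> space M \<and> S \<in> sets borel"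
          by (intro exI[of _ "g -` A"]) auto
      qed
      ultimately show ?thesis by simp
    qed
    moreover have "sigma_sets (space M) {\<phi> -` A \<inter> space M | A. A \<in> sets borel} \<subseteq> G"
    proof -
      have sp: "space F = space M" using F by (simp add: subalgebra_def)
      have "{\<phi> -` A \<inter> space M | A. A \<in> sets borel} \<subseteq> sets F"
        using measurable_sets[OF \<phi>(1)] sp by auto
      then have "sigma_sets (space F) {\<phi> -` A \<inter> space M | A. A \<in> sets borel} \<subseteq> sets F"
        by (rule sets.sigma_sets_subset)
      then show ?thesis using G sp by auto
    qed
    ultimately show ?thesis
      using indep unfolding indep_sets2_eq by blast
  qed
  then have "indep_var borel N borel \<phi>"
    using int \<phi> unfolding indep_var_eq by auto
  then show "integrable M (\<lambda>\<omega>. N \<omega> * \<phi> \<omega>)" "expectation (\<lambda>\<omega>. N \<omega> * \<phi> \<omega>) = 0"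
    using indep_var_integrable[OF _ int(1) \<phi>(2)] indep_var_lebesgue_integral[OF _ int(1) \<phi>(2)] int(2)
    by auto
qed

text \<open>Measurability of \<open>f\<close> is given at fixed points, but losses are evaluated at
  random ones. The point \<open>x\<close> is replaced by the first member of a countable dense
  subset within \<open>1 / (n + 1)\<close>; its index is measurable with countable range, and
  continuity in the point gives the limit.\<close>

lemma borel_measurable_caratheodory:
  fixes f :: "'a \<Rightarrow> 'b::euclidean_space \<Rightarrow> real"
  assumes f: "\<And>v. v \<in> X \<Longrightarrow> (\<lambda>\<omega>. f \<omega> v) \<in> borel_measurable M"
    and cont: "\<And>\<omega>. \<omega> \<in> space M \<Longrightarrow> continuous_on X (f \<omega>)"
    and x[measurable]: "x \<in> borel_measurable M" and xX: "\<And>\<omega>. \<omega> \<in> space M \<Longrightarrow> x \<omega> \<in> X"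
  shows "(\<lambda>\<omega>. f \<omega> (x \<omega>)) \<in> borel_measurable M"
proof (cases "space M = {}")
  case True
  then show ?thesis by (simp add: measurable_def)
next
  case False
  obtain T where T: "countable T" "T \<subseteq> X" "X \<subseteq> closure T" by (rule separable)
  have "T \<noteq> {}" using False xX T(3) by auto
  then have rng: "range (from_nat_into T) = T" using T(1) by (rule range_from_nat_into)
  let ?e = "from_nat_into T"
  have eX: "?e m \<in> X" for m using rng T(2) by blast
  define k where "k n \<omega> = (LEAST m. dist (x \<omega>) (?e m) < 1 / real (Suc n))" for n \<omega>
  have k[measurable]: "k n \<in> measurable M (count_space UNIV)" for n
    unfolding k_def by measurable
  have close: "dist (x \<omega>) (?e (k n \<omega>)) < 1 / real (Suc n)" if \<omega>: "\<omega> \<in> space M" for n \<omega>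
  proof -
    obtain v where "v \<in> T" "dist v (x \<omega>) < 1 / real (Suc n)"
      using xX[OF \<omega>] T(3) closure_approachable[of "x \<omega>" T]
      by (metis of_nat_0_less_iff subsetD zero_less_Suc zero_less_divide_1_iff)
    then have "\<exists>m. dist (x \<omega>) (?e m) < 1 / real (Suc n)"
      using rng by (metis dist_commute imageE)
    then show ?thesis unfolding k_def by (rule LeastI_ex)
  qed
  show ?thesis
  proof (rule borel_measurable_LIMSEQ_real)
    fix n show "(\<lambda>\<omega>. f \<omega> (?e (k n \<omega>))) \<in> borel_measurable M"
      by (rule measurable_compose_countable[OF f[OF eX] k])
  next
    fix \<omega> assume \<omega>: "\<omega> \<in> space M"
    have "(\<lambda>n. ?e (k n \<omega>)) \<longlonglongrightarrow> x \<omega>"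
    proof (rule metric_tendsto_imp_tendsto)
      show "(\<lambda>n. 1 / real (Suc n)) \<longlonglongrightarrow> 0" by (rule LIMSEQ_Suc[OF lim_1_over_n])
      show "\<forall>\<^sub>F n in sequentially. dist (?e (k n \<omega>)) (x \<omega>) \<le> dist (1 / real (Suc n)) 0"
        using close[OF \<omega>] by (intro always_eventually allI) (auto simp: dist_commute less_imp_le)
    qed
    then show "(\<lambda>n. f \<omega> (?e (k n \<omega>))) \<longlonglongrightarrow> f \<omega> (x \<omega>)"
      by (rule continuous_on_tendsto_compose[OF cont[OF \<omega>]]) (use xX \<omega> eX in auto)
  qed
qed

lemma borel_measurable_vec_nth [measurable (raw)]:
  fixes Y :: "'a \<Rightarrow> 'b::real_normed_vector ^ 'n"
  assumes "Y \<in> borel_measurable M"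
  shows "(\<lambda>\<omega>. Y \<omega> $ i) \<in> borel_measurable M"
  by (rule borel_measurable_continuous_on[OF _ assms]) (rule linear_continuous_on[OF bounded_linear_vec_nth])

lemma borel_measurable_vec_lambda:
  fixes g :: "'n::finite \<Rightarrow> 'a \<Rightarrow> real"
  assumes [measurable]: "\<And>i. g i \<in> borel_measurable M"
  shows "(\<lambda>\<omega>. \<chi> i. g i \<omega>) \<in> borel_measurable M"
proof -
  have eq: "(\<chi> i. g i \<omega>) = (\<Sum>i\<in>UNIV. g i \<omega> *\<^sub>R axis i (1::real))" for \<omega>
  proof -
    have "(\<Sum>i\<in>UNIV. g i \<omega> *\<^sub>R axis i (1::real)) $ k = (\<Sum>i\<in>UNIV. if i = k then g i \<omega> else 0)" for k
      unfolding sum_component by (intro sum.cong) (auto simp: axis_def)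
    then show ?thesis by (simp add: vec_eq_iff)
  qed
  show ?thesis unfolding eq by measurable
qed

lemma preimages_subset_sets: "Y \<in> borel_measurable M \<Longrightarrow> preimages M Y \<subseteq> sets M"
  by (auto simp: preimages_def measurable_sets)

lemma subalgebra_history:
  assumes "\<And>t. z t \<in> borel_measurable M" "\<And>t. h t \<in> borel_measurable M"
    "\<And>t. u t \<in> borel_measurable M" "\<And>t. y t \<in> borel_measurable M"
  shows "subalgebra M (history M z h u y t)"
proof -
  let ?G = "preimages M (y 0) \<union>
      (\<Union>s<t. preimages M (z s) \<union> preimages M (h s) \<union> preimages M (u s) \<union> preimages M (y s))"
  have G: "?G \<subseteq> sets M"
    by (intro Un_least UN_least preimages_subset_sets assms)
  then have "?G \<subseteq> Pow (space M)" using sets.space_closed by blast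
  then have "sets (history M z h u y t) = sigma_sets (space M) ?G"
    unfolding history_def by (rule sets_measure_of)
  then show ?thesis
    using sets.sigma_sets_subset[OF G] by (simp add: subalgebra_def history_def space_measure_of_conv)
qed

lemma borel_measurable_history:
  assumes "s < t"
  shows "z s \<in> borel_measurable (history M z h u y t)" "h s \<in> borel_measurable (history M z h u y t)"
    "u s \<in> borel_measurable (history M z h u y t)"
proof -
  let ?G = "preimages M (y 0) \<union>
      (\<Union>s<t. preimages M (z s) \<union> preimages M (h s) \<union> preimages M (u s) \<union> preimages M (y s))"
  have "?G \<subseteq> Pow (space M)" by (auto simp: preimages_def)
  then have "?G \<subseteq> sets (history M z h u y t)" by (auto simp: history_def)
  then have "preimages M (z s) \<subseteq> sets (history M z h u y t)"
    "preimages M (h s) \<subseteq> sets (history M z h u y t)"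
    "preimages M (u s) \<subseteq> sets (history M z h u y t)"
    using assms by blast+
  moreover have "space (history M z h u y t) = space M"
    by (simp add: history_def space_measure_of_conv)
  ultimately show "z s \<in> borel_measurable (history M z h u y t)"
    "h s \<in> borel_measurable (history M z h u y t)" "u s \<in> borel_measurable (history M z h u y t)"
    by (auto intro: borel_measurable_of_preimages)
qed

lemma integrable_mult_bounded:
  fixes N \<phi> :: "'a \<Rightarrow> real"
  assumes "integrable M N" "\<phi> \<in> borel_measurable M" "\<And>\<omega>. \<omega> \<in> space M \<Longrightarrow> \<bar>\<phi> \<omega>\<bar> \<le> b"
  shows "integrable M (\<lambda>\<omega>. N \<omega> * \<phi> \<omega>)"
proof (rule Bochner_Integration.integrable_bound)
  show "integrable M (\<lambda>\<omega>. b * N \<omega>)" using assms(1) by simp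
  show "(\<lambda>\<omega>. N \<omega> * \<phi> \<omega>) \<in> borel_measurable M" using assms by measurable
  show "AE \<omega> in M. norm (N \<omega> * \<phi> \<omega>) \<le> norm (b * N \<omega>)"
  proof (rule AE_I2)
    fix \<omega> assume "\<omega> \<in> space M"
    then have "\<bar>\<phi> \<omega>\<bar> \<le> \<bar>b\<bar>" using assms(3)[of \<omega>] by linarith
    then show "norm (N \<omega> * \<phi> \<omega>) \<le> norm (b * N \<omega>)"
      using mult_left_mono[of "\<bar>\<phi> \<omega>\<bar>" "\<bar>b\<bar>" "\<bar>N \<omega>\<bar>"] by (simp add: abs_mult mult.commute)
  qed
qed

text \<open>The nonnegative conditional expectation is meaningful before integrability is known, so
  finiteness of the second moment comes out of taking total expectations.\<close>

lemma (in prob_space) conditional_second_moment: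
  fixes N :: "'a \<Rightarrow> real"
  assumes F: "subalgebra M F" and [measurable]: "N \<in> borel_measurable M"
    and le: "AE \<omega> in M. nn_cond_exp M F (\<lambda>\<omega>. ennreal (\<bar>N \<omega>\<bar>\<^sup>2)) \<omega> \<le> ennreal (c\<^sup>2)"
  shows "integrable M (\<lambda>\<omega>. (N \<omega>)\<^sup>2)" "expectation (\<lambda>\<omega>. (N \<omega>)\<^sup>2) \<le> c\<^sup>2"
proof -
  interpret finite_measure_subalgebra M F by unfold_locales (rule F)
  have "(\<integral>\<^sup>+\<omega>. ennreal ((N \<omega>)\<^sup>2) \<partial>M) = (\<integral>\<^sup>+\<omega>. 1 * nn_cond_exp M F (\<lambda>\<omega>. ennreal (\<bar>N \<omega>\<bar>\<^sup>2)) \<omega> \<partial>M)"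
    using nn_cond_exp_intg[of "\<lambda>_. 1" "\<lambda>\<omega>. ennreal (\<bar>N \<omega>\<bar>\<^sup>2)"] by simp
  also have "\<dots> \<le> (\<integral>\<^sup>+\<omega>. ennreal (c\<^sup>2) \<partial>M)"
    using le by (intro nn_integral_mono_AE) auto
  also have "\<dots> = ennreal (c\<^sup>2)" by (simp add: emeasure_space_1)
  finally have le: "(\<integral>\<^sup>+\<omega>. ennreal ((N \<omega>)\<^sup>2) \<partial>M) \<le> ennreal (c\<^sup>2)" .
  show "integrable M (\<lambda>\<omega>. (N \<omega>)\<^sup>2)"
    using le by (intro integrableI_nonneg) (auto simp: le_less_trans)
  then have "ennreal (expectation (\<lambda>\<omega>. (N \<omega>)\<^sup>2)) = (\<integral>\<^sup>+\<omega>. ennreal ((N \<omega>)\<^sup>2) \<partial>M)"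
    by (intro nn_integral_eq_integral[symmetric]) auto
  also note le
  finally show "expectation (\<lambda>\<omega>. (N \<omega>)\<^sup>2) \<le> c\<^sup>2" by (subst (asm) ennreal_le_iff) auto
qed

lemma (in prob_space) expectation_mult_cond_exp:
  fixes N \<phi> p :: "'a \<Rightarrow> real"
  assumes F: "subalgebra M F" and N: "integrable M N"
    and \<phi>: "\<phi> \<in> borel_measurable F" "\<And>\<omega>. \<omega> \<in> space M \<Longrightarrow> \<bar>\<phi> \<omega>\<bar> \<le> b"
    and p: "p \<in> borel_measurable M" "AE \<omega> in M. real_cond_exp M F N \<omega> = p \<omega>"
  shows "integrable M (\<lambda>\<omega>. p \<omega> * \<phi> \<omega>)"
    "expectation (\<lambda>\<omega>. N \<omega> * \<phi> \<omega>) = expectation (\<lambda>\<omega>. p \<omega> * \<phi> \<omega>)"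
proof -
  interpret finite_measure_subalgebra M F by unfold_locales (rule F)
  have [measurable]: "\<phi> \<in> borel_measurable M" by (rule measurable_from_subalg[OF F \<phi>(1)])
  have "integrable M (\<lambda>\<omega>. N \<omega> * \<phi> \<omega>)" by (rule integrable_mult_bounded[OF N _ \<phi>(2)]) measurable
  then have int: "integrable M (\<lambda>\<omega>. \<phi> \<omega> * N \<omega>)" by (simp add: mult.commute)
  note ce = real_cond_exp_intg[OF int \<phi>(1) borel_measurable_integrable[OF N]]
  have ae: "AE \<omega> in M. \<phi> \<omega> * real_cond_exp M F N \<omega> = p \<omega> * \<phi> \<omega>"
    using p(2) by eventually_elim simp
  have meas: "(\<lambda>\<omega>. \<phi> \<omega> * real_cond_exp M F N \<omega>) \<in> borel_measurable M" "(\<lambda>\<omega>. p \<omega> * \<phi> \<omega>) \<in> borel_measurable M"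
    using p(1) by measurable
  show "integrable M (\<lambda>\<omega>. p \<omega> * \<phi> \<omega>)"
    using ce(1) integrable_cong_AE[OF meas ae] by simp
  show "expectation (\<lambda>\<omega>. N \<omega> * \<phi> \<omega>) = expectation (\<lambda>\<omega>. p \<omega> * \<phi> \<omega>)"
    using ce(2) integral_cong_AE[OF meas ae] by (simp add: mult.commute)
qed

section \<open>Regret of a single run\<close>

text \<open>The gradient is taken within \<open>X\<close>, where a boundary point allows only inward
  directions. Hence the function is differentiated along the segment from \<open>x\<close> to
  \<open>y\<close>, as a one-sided derivative at 0, and convexity bounds the difference
  quotients.\<close>

lemma convex_on_gradient_le:
  fixes f :: "'a::real_inner \<Rightarrow> real"
  assumes cf: "convex_on X f" and g: "gradient_on X f df" and x: "x \<in> X" and y: "y \<in> X"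
  shows "f x - f y \<le> df x \<bullet> (x - y)"
proof -
  have conv: "convex X" using cf by (simp add: convex_on_def)
  let ?l = "\<lambda>c::real. x + c *\<^sub>R (y - x)"
  have l: "?l c = (1 - c) *\<^sub>R x + c *\<^sub>R y" for c
    by (simp add: algebra_simps)
  have lX: "?l ` {0..1} \<subseteq> X"
    unfolding l using convexD_alt[OF conv x y] by auto
  have "(f has_derivative (\<lambda>d. df x \<bullet> d)) (at (?l 0) within X)"
    using g x by (simp add: gradient_on_def)
  then have "(f has_derivative (\<lambda>d. df x \<bullet> d)) (at (?l 0) within ?l ` {0..1})"
    using lX by (rule has_derivative_subset)
  then have "(f \<circ> ?l has_derivative (\<lambda>d. df x \<bullet> d) \<circ> (\<lambda>c. c *\<^sub>R (y - x))) (at 0 within {0..1})"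
    by (intro diff_chain_within) (auto intro!: derivative_eq_intros)
  then have "((f \<circ> ?l) has_field_derivative (df x \<bullet> (y - x))) (at 0 within {0..1})"
    by (rule has_derivative_imp_has_field_derivative) (simp add: mult.commute)
  then have lim: "((\<lambda>c. (f (?l c) - f x) / c) \<longlongrightarrow> df x \<bullet> (y - x)) (at 0 within {0..1})"
    by (simp add: has_field_derivative_iff)
  have "df x \<bullet> (y - x) \<le> f y - f x"
  proof (rule tendsto_upperbound[OF lim])
    have le: "(f (?l c) - f x) / c \<le> f y - f x" if "0 < c" "c \<le> 1" for c
    proof -
      have "f (?l c) \<le> (1 - c) * f x + c * f y"
        using convex_onD[OF cf, of c x y] that x y by (simp only: l)
      then have "f (?l c) - f x \<le> (f y - f x) * c" by (simp add: left_diff_distrib right_diff_distrib mult.commute)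
      then show ?thesis using that by (simp add: pos_divide_le_eq)
    qed
    show "\<forall>\<^sub>F c in at 0 within {0..1}. (f (?l c) - f x) / c \<le> f y - f x"
      unfolding eventually_at_filter
    proof (intro always_eventually allI impI)
      fix c :: real assume "c \<noteq> 0" "c \<in> {0..1}"
      then show "(f (?l c) - f x) / c \<le> f y - f x" by (intro le) auto
    qed
    show "at (0::real) within {0..1} \<noteq> bot"
      by (simp add: at_within_Icc_at_right)
  qed
  then show ?thesis by (simp add: inner_diff_right)
qed

lemma convex_on_gradient_bounded_imp_le:
  fixes f :: "'a::real_inner \<Rightarrow> real"
  assumes "convex_on X f" "gradient_on X f df" "x \<in> X" "y \<in> X" "norm (df x) \<le> L"
  shows "f x - f y \<le> L * norm (x - y)"
proof -
  have "f x - f y \<le> df x \<bullet> (x - y)" using assms by (intro convex_on_gradient_le)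
  also have "\<dots> \<le> norm (df x) * norm (x - y)" by (rule norm_cauchy_schwarz)
  also have "\<dots> \<le> L * norm (x - y)" using assms(5) by (rule mult_right_mono) simp
  finally show ?thesis .
qed

lemma norm_le_sqrt_CARD:
  fixes v :: "real ^ 'n"
  assumes "\<And>i. \<bar>v $ i\<bar> \<le> b"
  shows "norm v \<le> sqrt (real CARD('n)) * b"
proof -
  have b: "0 \<le> b" using assms[of undefined] by linarith
  have "(norm v)\<^sup>2 = (\<Sum>i\<in>UNIV. (v $ i)\<^sup>2)"
    unfolding power2_norm_eq_inner inner_vec_def by (simp only: inner_real_def power2_eq_square)
  also have "\<dots> \<le> (\<Sum>i\<in>(UNIV :: 'n set). b\<^sup>2)"
  proof (rule sum_mono)
    fix i show "(v $ i)\<^sup>2 \<le> b\<^sup>2" using power_mono[OF assms[of i], of 2] by simp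
  qed
  also have "\<dots> = (sqrt (real CARD('n)) * b)\<^sup>2" by (simp add: power_mult_distrib)
  finally show ?thesis by (rule power2_le_imp_le) (simp add: b)
qed

lemma cart_power_diameter:
  fixes X :: "(real ^ 'n::finite) set"
  assumes X: "X = cart_power chi" "X \<noteq> {}" and chi: "bounded chi"
    and D: "D = (SUP (r, s)\<in>chi \<times> chi. \<bar>r - s\<bar>)"
  shows "\<And>v v' i. v \<in> X \<Longrightarrow> v' \<in> X \<Longrightarrow> \<bar>v $ i - v' $ i\<bar> \<le> D" "0 \<le> D" "bounded X"
proof -
  obtain b where b: "\<And>r. r \<in> chi \<Longrightarrow> \<bar>r\<bar> \<le> b"
    using chi by (auto simp: bounded_iff)
  have le: "\<bar>r - s\<bar> \<le> D" if "r \<in> chi" "s \<in> chi" for r s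
  proof -
    have "(\<lambda>(r, s). \<bar>r - s\<bar>) (r, s) \<le> D"
      unfolding D
    proof (rule cSUP_upper)
      have "(\<lambda>(r, s). \<bar>r - s\<bar>) p \<le> b + b" if "p \<in> chi \<times> chi" for p
        using that b[of "fst p"] b[of "snd p"] by (cases p) auto
      then show "bdd_above ((\<lambda>(r, s). \<bar>r - s\<bar>) ` (chi \<times> chi))"
        by (rule bdd_aboveI2)
    qed (use that in auto)
    then show ?thesis by simp
  qed
  then show coord: "\<bar>v $ i - v' $ i\<bar> \<le> D" if "v \<in> X" "v' \<in> X" for v v' i
    using that by (simp add: X(1) cart_power_def)
  obtain v where v: "v \<in> X" using X(2) by blast
  show "0 \<le> D" using coord[OF v v, of undefined] by simp
  have "norm x \<le> sqrt (real CARD('n)) * b" if "x \<in> X" for x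
    using that b by (intro norm_le_sqrt_CARD) (auto simp: X(1) cart_power_def)
  then show "bounded X" by (auto simp: bounded_iff)
qed

text \<open>Strong convexity is used at the midpoint of the constant vectors with entries
  \<open>r\<close> and \<open>s\<close>, whose squared distance is \<open>n * (r - s) ^ 2\<close>.
  An eighth of it is at most the drop of \<open>psi\<close> at the midpoint, which cannot exceed
  \<open>C\<close>.\<close>

lemma strongly_convex_diameter_le:
  fixes X :: "(real ^ 'n::finite) set"
  assumes X: "X = cart_power chi" "X \<noteq> {}" "convex X" and psi: "strongly_convex_on 1 X psi"
    and psi_bounds: "\<And>v. v \<in> X \<Longrightarrow> 0 \<le> psi v" "\<And>v. v \<in> X \<Longrightarrow> psi v \<le> C"
    and D: "D = (SUP (r, s)\<in>chi \<times> chi. \<bar>r - s\<bar>)" and D0: "0 \<le> D"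
  shows "real CARD('n) * D\<^sup>2 \<le> 8 * C"
proof -
  have le: "\<bar>r - s\<bar> \<le> sqrt (8 * C / real CARD('n))" if "r \<in> chi" "s \<in> chi" for r s
  proof -
    let ?r = "\<chi> i. r" and ?s = "\<chi> i. s :: real ^ 'n"
    have rs: "?r \<in> X" "?s \<in> X" using that by (simp_all add: X(1) cart_power_def)
    let ?m = "(1 - 1 / 2) *\<^sub>R ?r + (1 / 2) *\<^sub>R ?s"
    have "?m \<in> X" using rs convexD_alt[OF X(3) rs, of "1 / 2"] by simp
    then have "0 \<le> psi ?m" by (rule psi_bounds(1))
    also have "psi ?m \<le> (1 - 1 / 2) * psi ?r + 1 / 2 * psi ?s
        - 1 / 2 * (1 / 2) * (1 - 1 / 2) * (norm (?r - ?s))\<^sup>2"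
      using psi rs unfolding strongly_convex_on_def by (elim ballE[of _ _ "1 / 2"] ballE) auto
    finally have "(norm (?r - ?s))\<^sup>2 \<le> 8 * C"
      using psi_bounds(2)[OF rs(1)] psi_bounds(2)[OF rs(2)] by (simp add: field_simps)
    moreover have "(norm (?r - ?s))\<^sup>2 = real CARD('n) * (r - s)\<^sup>2"
      unfolding power2_norm_eq_inner inner_vec_def by (simp add: power2_eq_square)
    ultimately have "(r - s)\<^sup>2 \<le> 8 * C / real CARD('n)"
      by (simp add: pos_le_divide_eq mult.commute)
    then show ?thesis by (metis real_sqrt_abs real_sqrt_le_iff)
  qed
  obtain v where "v \<in> X" using X(2) by blast
  then have ne: "v $ undefined \<in> chi" "0 \<le> C"
    using psi_bounds[of v] by (auto simp: X(1) cart_power_def)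
  have "D \<le> sqrt (8 * C / real CARD('n))"
    unfolding D using ne le by (intro cSUP_least) auto
  then have "D\<^sup>2 \<le> 8 * C / real CARD('n)"
    using ne(2) D0 power_mono[of D "sqrt (8 * C / real CARD('n))" 2] by simp
  then show ?thesis by (simp add: pos_le_divide_eq mult.commute)
qed

lemma step_size_pos: "0 < step_size t"
  by (simp add: step_size_def)

lemma step_size_Suc_le: "step_size (Suc t) \<le> step_size t"
  by (cases "t = 0") (auto simp: step_size_def frac_le)

text \<open>The value 1 at index 0 is a surplus over the usual sum, so the induction proves the
  sharper bound with the root of the last index. It rests on \<open>1 / s \<le> 2 * (s - r)\<close>
  for consecutive roots \<open>r\<close> and \<open>s\<close>.\<close>

lemma sum_step_size_le:
  assumes "1 \<le> T"
  shows "(\<Sum>t<T. step_size t) \<le> 2 * sqrt (real T)"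
proof -
  have le: "(\<Sum>t<Suc (Suc m). step_size t) \<le> 2 * sqrt (real (Suc m))" for m
  proof (induction m)
    case (Suc m)
    define r s where "r = sqrt (real (Suc m))" and "s = sqrt (real (Suc (Suc m)))"
    have "s\<^sup>2 = r\<^sup>2 + 1" "0 < s" by (simp_all add: r_def s_def)
    moreover have "2 * r * s \<le> r\<^sup>2 + s\<^sup>2" by (rule sum_squares_bound)
    ultimately have "(1 / s + 2 * r) * s \<le> (2 * s) * s"
      by (simp add: distrib_right power2_eq_square)
    then have "1 / s + 2 * r \<le> 2 * s" using \<open>0 < s\<close> by simp
    moreover have "step_size (Suc (Suc m)) = 1 / s" by (simp add: step_size_def s_def)
    ultimately show ?case using Suc by (simp add: r_def s_def)
  qed (simp add: step_size_def)
  show ?thesis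
  proof (cases "T = 1")
    case False
    define m where "m = T - 2"
    have T: "T = Suc (Suc m)" using assms False by (simp add: m_def)
    have "sqrt (real (Suc m)) \<le> sqrt (real T)" by (simp add: T)
    then show ?thesis using le[of m] unfolding T by linarith
  qed (simp add: step_size_def)
qed

text \<open>The factor \<open>n\<close> with which a node enters its gradient component cancels in
  the average, while the noise is genuinely averaged.\<close>

definition avg_input :: "real ^ 'n \<Rightarrow> real ^ 'n ^ 'n \<Rightarrow> real ^ 'n" where
  "avg_input u eta = u + (1 / real CARD('n)) *\<^sub>R (\<Sum>j\<in>UNIV. eta $ j)"

lemma borel_measurable_avg_input [measurable (raw)]:
  assumes [measurable]: "U \<in> borel_measurable M" "V \<in> borel_measurable M"
  shows "(\<lambda>\<omega>. avg_input (U \<omega>) (V \<omega>)) \<in> borel_measurable M"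
  unfolding avg_input_def by measurable

text \<open>Linear in the absolute values, so that first moments of gradients and noise control the
  disagreement.\<close>

definition input_size :: "real ^ 'n \<Rightarrow> real ^ 'n ^ 'n \<Rightarrow> real" where
  "input_size u eta = (\<Sum>j\<in>UNIV. real CARD('n) * \<bar>u $ j\<bar> + (\<Sum>k\<in>UNIV. \<bar>eta $ j $ k\<bar>))"

definition disagreement ::
    "nat \<Rightarrow> (nat \<Rightarrow> real ^ 'n) \<Rightarrow> (nat \<Rightarrow> real ^ 'n ^ 'n) \<Rightarrow> nat \<Rightarrow> real" where
  "disagreement B u eta t = (\<Sum>s<t. mixing_rate CARD('n) B ^ ((t - Suc s) div (CARD('n) * B))
     * input_size (u s) (eta s))"

text \<open>One fixed realisation: everything in this locale is deterministic, and expectations are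
  taken only afterwards.\<close>

locale dpsda_run = prox_function X psi + connected_network B E
  for X :: "(real ^ 'n::finite) set" and psi :: "real ^ 'n \<Rightarrow> real"
    and B :: nat and E :: "nat \<Rightarrow> ('n \<times> 'n) set" +
  fixes df :: "nat \<Rightarrow> real ^ 'n \<Rightarrow> real ^ 'n"
    and xi u x w :: "nat \<Rightarrow> real ^ 'n" and eta z h y :: "nat \<Rightarrow> real ^ 'n ^ 'n"
  assumes run: "dpsda_ps_run X psi E df xi eta z h w u y x"
    and two_nodes: "2 \<le> CARD('n)"
begin

definition dual_avg :: "nat \<Rightarrow> real ^ 'n" where
  "dual_avg t = (\<Sum>s<t. avg_input (u s) (eta s))"

text \<open>The step size is that of \<open>y (Suc t)\<close>, so that a node and the centralised
  point differ only in the dual vector.\<close>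

definition mean_iterate :: "nat \<Rightarrow> real ^ 'n" where
  "mean_iterate t = prox (step_size t) (dual_avg (Suc t))"

lemma mean_iterate_in: "mean_iterate t \<in> X"
  unfolding mean_iterate_def by (rule prox(1)[OF step_size_pos])

lemma w_eq_weight: "w t = weight t"
proof (induction t)
  case 0
  then show ?case using run by (simp add: dpsda_ps_run_def vec_eq_iff weight_0)
next
  case (Suc t)
  have "w (Suc t) = A t *v w t"
    using run by (simp add: dpsda_ps_run_def vec_eq_iff matrix_vector_mult_def)
  then show ?case by (simp add: Suc weight_Suc)
qed

text \<open>The mixed noise is counted as part of the input, which gives the recursion the form that
  \<open>push_sum_consensus\<close> expects.\<close>

lemma z_Suc:
  "z (Suc t) = ((\<chi> i k. real CARD('n) * (if i = k then 1 else 0) * u t $ i) + A t ** eta t) + A t ** z t"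
proof -
  have "h t = z t + eta t" using run by (simp add: dpsda_ps_run_def vec_eq_iff)
  then have "A t ** h t = A t ** eta t + A t ** z t" by (simp add: matrix_add_ldistrib add.commute)
  moreover have "z (Suc t) = (\<chi> i k. real CARD('n) * (if i = k then 1 else 0) * u t $ i) + A t ** h t"
    using run by (simp add: dpsda_ps_run_def vec_eq_iff matrix_matrix_mult_def)
  ultimately show ?thesis by simp
qed

lemma norm_push_sum_minus_dual_avg_le:
  "norm (z t $ i - weight t $ i *\<^sub>R dual_avg t) \<le> disagreement B u eta t"
proof -
  define U where "U t = (\<chi> i k. real CARD('n) * (if i = k then 1 else 0) * u t $ i)" for t
  define q where "q t = U t + A t ** eta t" for t
  have U: "norm (U t $ j) = real CARD('n) * \<bar>u t $ j\<bar>" for t j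
  proof -
    have "U t $ j = (real CARD('n) * u t $ j) *\<^sub>R axis j 1"
      by (simp add: U_def vec_eq_iff axis_def)
    then show ?thesis by (simp add: abs_mult)
  qed
  have "(1 / real CARD('n)) *\<^sub>R (\<Sum>j\<in>UNIV. q s $ j) = avg_input (u s) (eta s)" for s
  proof -
    have "(\<Sum>j\<in>UNIV. U s $ j) = real CARD('n) *\<^sub>R u s"
    proof -
      have "(\<Sum>j\<in>UNIV. U s $ j $ k) = (\<Sum>j\<in>UNIV. if j = k then real CARD('n) * u s $ j else 0)" for k
        by (intro sum.cong) (auto simp: U_def)
      then show ?thesis by (simp add: vec_eq_iff)
    qed
    then show ?thesis
      by (simp add: q_def sum.distrib sum_rows_col_stochastic_mult[OF col_stochastic_weight_mat]
          avg_input_def scaleR_add_right)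
  qed
  then have avg: "(1 / real CARD('n)) *\<^sub>R (\<Sum>s<t. \<Sum>j\<in>UNIV. q s $ j) = dual_avg t"
    by (simp add: dual_avg_def scaleR_sum_right)
  have size: "(\<Sum>j\<in>UNIV. norm (q s $ j)) \<le> input_size (u s) (eta s)" for s
  proof -
    have "(\<Sum>j\<in>UNIV. norm (q s $ j))
        \<le> (\<Sum>j\<in>UNIV. real CARD('n) * \<bar>u s $ j\<bar> + (\<Sum>k\<in>UNIV. \<bar>(A s ** eta s) $ j $ k\<bar>))"
    proof (rule sum_mono)
      fix j
      have "norm (q s $ j) \<le> norm (U s $ j) + norm ((A s ** eta s) $ j)"
        by (simp add: q_def norm_triangle_ineq)
      also have "norm (U s $ j) = real CARD('n) * \<bar>u s $ j\<bar>" by (rule U)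
      also have "norm ((A s ** eta s) $ j) \<le> (\<Sum>k\<in>UNIV. \<bar>(A s ** eta s) $ j $ k\<bar>)"
        by (rule norm_le_l1_cart)
      finally show "norm (q s $ j) \<le> real CARD('n) * \<bar>u s $ j\<bar> + (\<Sum>k\<in>UNIV. \<bar>(A s ** eta s) $ j $ k\<bar>)"
        by simp
    qed
    then show ?thesis
      using sum_abs_col_stochastic_mult_le[OF col_stochastic_weight_mat, of "E s" "eta s"]
      by (simp add: sum.distrib input_size_def)
  qed
  have "z 0 = 0" using run by (simp add: dpsda_ps_run_def vec_eq_iff)
  then have "norm (z t $ i - weight t $ i *\<^sub>R ((1 / real CARD('n)) *\<^sub>R (\<Sum>s<t. \<Sum>j\<in>UNIV. q s $ j)))
    \<le> (\<Sum>s<t. mixing_rate CARD('n) B ^ ((t - Suc s) div (CARD('n) * B)) * (\<Sum>j\<in>UNIV. norm (q s $ j)))"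
    by (rule push_sum_consensus) (simp add: q_def U_def z_Suc)
  also have "\<dots> \<le> disagreement B u eta t"
    unfolding disagreement_def using mixing_rate_nonneg[OF two_nodes] size
    by (intro sum_mono mult_left_mono) auto
  finally show ?thesis unfolding avg .
qed

lemma norm_iterate_minus_mean_le:
  assumes "0 < \<gamma>" "\<And>i. \<gamma> \<le> weight (Suc t) $ i"
  shows "norm (y (Suc t) $ i - mean_iterate t) \<le> step_size t * (disagreement B u eta (Suc t) / \<gamma>)"
proof -
  let ?w = "weight (Suc t) $ i" and ?W = "disagreement B u eta (Suc t)"
  have w: "\<gamma> \<le> ?w" "0 < ?w" using assms(1) assms(2)[of i] by auto
  have "is_prox X psi ((1 / ?w) *\<^sub>R z (Suc t) $ i) (step_size t) (y (Suc t) $ i)"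
    using run unfolding dpsda_ps_run_def w_eq_weight by blast
  then have y: "y (Suc t) $ i = prox (step_size t) ((1 / ?w) *\<^sub>R z (Suc t) $ i)"
    by (rule is_prox_eq_prox[OF prox_function_axioms step_size_pos])
  have "(1 / ?w) *\<^sub>R z (Suc t) $ i - dual_avg (Suc t)
      = (1 / ?w) *\<^sub>R (z (Suc t) $ i - ?w *\<^sub>R dual_avg (Suc t))"
    using w(2) by (simp add: scaleR_diff_right)
  then have "norm ((1 / ?w) *\<^sub>R z (Suc t) $ i - dual_avg (Suc t))
      = norm (z (Suc t) $ i - ?w *\<^sub>R dual_avg (Suc t)) / ?w"
    using w(2) by simp
  also have "\<dots> \<le> ?W / \<gamma>"
    using assms(1) w norm_push_sum_minus_dual_avg_le[of "Suc t" i]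
    by (intro frac_le) (auto intro: order_trans[OF norm_ge_zero])
  finally have "norm ((1 / ?w) *\<^sub>R z (Suc t) $ i - dual_avg (Suc t)) \<le> ?W / \<gamma>" .
  then have "step_size t * norm ((1 / ?w) *\<^sub>R z (Suc t) $ i - dual_avg (Suc t))
      \<le> step_size t * (?W / \<gamma>)"
    using step_size_pos[of t] by (intro mult_left_mono) auto
  then show ?thesis
    using prox_lipschitz[OF step_size_pos] unfolding y mean_iterate_def by (meson order_trans)
qed

text \<open>The comparison with the mean iterate replaces the gradients at the \<open>n\<close> different points
  \<open>y (Suc t) $ i\<close>, of which each node only uses its own component, by a single vector.\<close>

lemma loss_difference_le:
  assumes \<gamma>: "0 < \<gamma>" "\<And>i. \<gamma> \<le> weight (Suc t) $ i"
    and f: "convex_on X f" "gradient_on X f (df (Suc t))"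
    and L: "\<And>v. v \<in> X \<Longrightarrow> norm (df (Suc t) v) \<le> L"
    and G: "\<And>v v'. v \<in> X \<Longrightarrow> v' \<in> X \<Longrightarrow>
      norm (df (Suc t) v - df (Suc t) v') \<le> G * norm (v - v')" "0 \<le> G"
    and D: "\<And>v v' i. v \<in> X \<Longrightarrow> v' \<in> X \<Longrightarrow> \<bar>v $ i - v' $ i\<bar> \<le> D"
    and x: "x (Suc t) \<in> X" and v: "v \<in> X"
  shows "f (x (Suc t)) - f v
    \<le> sqrt (real CARD('n)) * (L + sqrt (real CARD('n)) * D * G)
        * (step_size t * (disagreement B u eta (Suc t) / \<gamma>))
      + (u (Suc t) - xi (Suc t)) \<bullet> (mean_iterate t - v)"
proof -
  let ?m = "mean_iterate t" and ?n = "real CARD('n)"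
  let ?\<delta> = "step_size t * (disagreement B u eta (Suc t) / \<gamma>)"
  have yX: "y (Suc t) $ i \<in> X" for i
    using run by (auto simp: dpsda_ps_run_def is_prox_def is_arg_min_def)
  have p: "(u (Suc t) - xi (Suc t)) $ i = df (Suc t) (y (Suc t) $ i) $ i" for i
    using run by (simp add: dpsda_ps_run_def inner_axis)
  have xy: "x (Suc t) $ i = y (Suc t) $ i $ i" for i
    using run by (simp add: dpsda_ps_run_def)
  have dist: "norm (y (Suc t) $ i - ?m) \<le> ?\<delta>" for i
    by (rule norm_iterate_minus_mean_le[OF \<gamma>])
  have L0: "0 \<le> L" using L[OF v] norm_ge_zero order_trans by blast
  \<comment> \<open>Coordinate \<open>i\<close> of the decision is taken from node \<open>i\<close>,
    so each coordinate separately is off by at most \<open>?\<delta>\<close>; this costs the factor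
    \<open>sqrt n\<close>.\<close>
  have "f (x (Suc t)) - f ?m \<le> L * norm (x (Suc t) - ?m)"
    by (rule convex_on_gradient_bounded_imp_le[OF f x mean_iterate_in L[OF x]])
  also have "norm (x (Suc t) - ?m) \<le> sqrt ?n * ?\<delta>"
  proof (rule norm_le_sqrt_CARD)
    fix i
    show "\<bar>(x (Suc t) - ?m) $ i\<bar> \<le> ?\<delta>"
      using component_le_norm_cart[of "y (Suc t) $ i - ?m" i] dist[of i] by (simp add: xy)
  qed
  finally have 1: "f (x (Suc t)) - f ?m \<le> L * (sqrt ?n * ?\<delta>)"
    using L0 by (simp add: mult_left_mono)
  have "f ?m - f v \<le> df (Suc t) ?m \<bullet> (?m - v)"
    by (rule convex_on_gradient_le[OF f mean_iterate_in v])
  also have "\<dots> = (df (Suc t) ?m - (u (Suc t) - xi (Suc t))) \<bullet> (?m - v)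
      + (u (Suc t) - xi (Suc t)) \<bullet> (?m - v)"
    by (simp add: inner_diff_left)
  \<comment> \<open>Every coordinate has its own point of evaluation, so the Lipschitz bound is
    applied \<open>n\<close> times, each time with \<open>D\<close> for the coordinate of
    \<open>?m - v\<close>.\<close>
  also have "(df (Suc t) ?m - (u (Suc t) - xi (Suc t))) \<bullet> (?m - v) \<le> (\<Sum>i\<in>(UNIV :: 'n set). (G * ?\<delta>) * D)"
    unfolding inner_vec_def
  proof (rule sum_mono)
    fix i
    have "\<bar>(df (Suc t) ?m - (u (Suc t) - xi (Suc t))) $ i\<bar> = \<bar>(df (Suc t) ?m - df (Suc t) (y (Suc t) $ i)) $ i\<bar>"
      using p[of i] by simp
    also have "\<dots> \<le> norm (df (Suc t) ?m - df (Suc t) (y (Suc t) $ i))"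
      by (rule component_le_norm_cart)
    also have "\<dots> \<le> G * norm (?m - y (Suc t) $ i)" by (rule G(1)[OF mean_iterate_in yX])
    also have "\<dots> \<le> G * ?\<delta>" using dist[of i] G(2) by (intro mult_left_mono) (simp_all add: norm_minus_commute)
    finally have "\<bar>(df (Suc t) ?m - (u (Suc t) - xi (Suc t))) $ i\<bar> * \<bar>(?m - v) $ i\<bar> \<le> (G * ?\<delta>) * D"
      using D[OF mean_iterate_in v, of t i] by (intro mult_mono) auto
    then show "(df (Suc t) ?m - (u (Suc t) - xi (Suc t))) $ i \<bullet> (?m - v) $ i \<le> (G * ?\<delta>) * D"
      unfolding inner_real_def abs_mult[symmetric] by (rule order_trans[OF abs_ge_self])
  qed
  finally have 2: "f ?m - f v \<le> ?n * ((G * ?\<delta>) * D) + (u (Suc t) - xi (Suc t)) \<bullet> (?m - v)"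
    by simp
  have "r * (L + r * D * G) * \<delta> = L * (r * \<delta>) + (r * r) * ((G * \<delta>) * D)" for r \<delta> :: real
    by (simp add: algebra_simps)
  then have "sqrt ?n * (L + sqrt ?n * D * G) * ?\<delta> = L * (sqrt ?n * ?\<delta>) + (sqrt ?n * sqrt ?n) * ((G * ?\<delta>) * D)"
    by this
  also have "sqrt ?n * sqrt ?n = ?n" by simp
  finally show ?thesis using 1 2 by linarith
qed

lemma sum_avg_input_le:
  assumes v: "v \<in> X" and d: "\<And>x. x \<in> X \<Longrightarrow> norm (v - x) \<le> d"
  shows "(\<Sum>t<T. avg_input (u (Suc t)) (eta (Suc t)) \<bullet> (mean_iterate t - v))
    \<le> norm (avg_input (u 0) (eta 0)) * d + 1 / step_size T * psi v
      + (\<Sum>t<T. step_size t / 2 * (norm (avg_input (u (Suc t)) (eta (Suc t))))\<^sup>2)"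
  unfolding mean_iterate_def
  by (rule dual_averaging[where a = step_size and g = "\<lambda>t. avg_input (u t) (eta t)",
        OF step_size_pos step_size_Suc_le _ _ v d]) (simp_all add: dual_avg_def)

end

section \<open>The constants\<close>

text \<open>Bernoulli's inequality for \<open>1 / lam\<close>, whose power \<open>B\<close> is
  \<open>1 / (1 - \<delta>)\<close> with \<open>\<delta> = 1 / N ^ (N * B)\<close>, gives
  \<open>B * (1 - lam) \<le> 2 * \<delta>\<close>. The left side of the third claim is
  \<open>B * N ^ ((N - 1) * B)\<close>, and
  \<open>N ^ ((N - 1) * B) * \<delta> = 1 / N ^ B \<le> 1 / N\<close>.\<close>

lemma spectral_gap_le:
  fixes N B :: nat
  assumes N: "2 \<le> N" and B: "0 < B" and lam: "lam = (1 - 1 / real N ^ (N * B)) powr (1 / real B)"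
  shows "0 < lam" "lam < 1"
    "real (N * B) / (1 - mixing_rate N B) \<le> 2 / (real N * (1 - lam))"
proof -
  define \<delta> where "\<delta> = 1 / real N ^ (N * B)"
  have "(2::real) ^ 1 \<le> real N ^ (N * B)"
    using N B by (intro order_trans[OF power_increasing[of 1 "N * B" "2::real"] power_mono]) auto
  then have \<delta>: "0 < \<delta>" "\<delta> \<le> 1 / 2" using N by (simp_all add: \<delta>_def frac_le)
  have lam': "lam = (1 - \<delta>) powr (1 / real B)" by (simp add: lam \<delta>_def)
  show lam0: "0 < lam" using \<delta> by (simp add: lam')
  have "(1 - \<delta>) powr (1 / real B) < 1 powr (1 / real B)"
    using \<delta> B by (intro powr_less_mono2) auto
  then show lam1: "lam < 1" by (simp add: lam')
  have "lam ^ B = lam powr real B" using lam0 by (simp add: powr_realpow)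
  also have "\<dots> = 1 - \<delta>" using \<delta> B by (simp add: lam' powr_powr)
  finally have lamB: "lam ^ B = 1 - \<delta>" .
  have "1 + real B * (1 / lam - 1) \<le> (1 + (1 / lam - 1)) ^ B"
    using lam0 lam1 by (intro Bernoulli_inequality) (simp add: field_simps)
  also have "\<dots> = 1 / (1 - \<delta>)" using lamB by (simp add: power_one_over)
  also have "\<dots> \<le> 1 + 2 * \<delta>"
  proof -
    have "0 \<le> \<delta> * (1 - 2 * \<delta>)" using \<delta> by simp
    then have "1 \<le> (1 + 2 * \<delta>) * (1 - \<delta>)" by (simp add: algebra_simps)
    then show ?thesis using \<delta> by (simp add: pos_divide_le_eq)
  qed
  finally have "real B * (1 / lam - 1) \<le> 2 * \<delta>" by simp
  moreover have "1 - lam \<le> 1 / lam - 1"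
  proof -
    have "0 \<le> (1 - lam)\<^sup>2 / lam" using lam0 by simp
    then show ?thesis using lam0 by (simp add: power2_diff field_simps power2_eq_square)
  qed
  ultimately have gap: "real B * (1 - lam) \<le> 2 * \<delta>"
    by (meson mult_left_mono of_nat_0_le_iff order_trans)
  have split: "real N ^ (N * B) = real N ^ ((N - 1) * B) * real N ^ B"
    using N by (simp add: diff_mult_distrib flip: power_add)
  have "real N \<le> real N ^ B" using N B self_le_power[of "real N" B] by simp
  then have "real N * (real N ^ ((N - 1) * B) * \<delta>) \<le> 1"
    using N by (simp add: \<delta>_def split)
  have "real (N * B) / (1 - mixing_rate N B) = real B * real N ^ ((N - 1) * B)"
    using N by (simp add: mixing_rate_def)
  also have "\<dots> \<le> 2 / (real N * (1 - lam))"
  proof -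
    have "real B * real N ^ ((N - 1) * B) * (real N * (1 - lam))
        = real N * real N ^ ((N - 1) * B) * (real B * (1 - lam))" by (simp only: mult_ac)
    also have "\<dots> \<le> real N * real N ^ ((N - 1) * B) * (2 * \<delta>)"
      using gap by (intro mult_left_mono) auto
    also have "\<dots> = 2 * (real N * (real N ^ ((N - 1) * B) * \<delta>))" by simp
    also have "\<dots> \<le> 2" using \<open>real N * _ \<le> 1\<close> by simp
    finally show ?thesis using N lam1 by (simp add: pos_le_divide_eq)
  qed
  finally show "real (N * B) / (1 - mixing_rate N B) \<le> 2 / (real N * (1 - lam))" .
qed

text \<open>The quantity \<open>q\<close> is the common numerator left when \<open>lam ^ 2\<close>
  in the first denominator of \<open>Q\<close> is raised to 1. The first bound reaches it through
  \<open>(1 + x) ^ 2 \<le> 2 * (1 + x ^ 2)\<close>, the second through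
  \<open>4 * n \<le> n ^ 3\<close>, where \<open>2 \<le> n\<close> enters.\<close>

lemma network_constant:
  fixes n Lhat \<epsilon> \<gamma> lam S Q :: real
  assumes pos: "2 \<le> n" "0 < Lhat" "0 < \<epsilon>" "0 < \<gamma>" "\<gamma> \<le> 1" "0 < lam" "lam < 1"
    and S: "0 \<le> S" "S \<le> 2 / (n * (1 - lam))"
    and Q: "Q = 8 * n ^ 3 * 2\<^sup>2 * Lhat\<^sup>2 / (\<gamma>\<^sup>2 * lam\<^sup>2 * (1 - lam)\<^sup>2)
                  + 64 * n ^ 5 * 2\<^sup>2 * Lhat\<^sup>2 / (\<gamma>\<^sup>2 * (1 - lam)\<^sup>2 * \<epsilon>\<^sup>2)"
  shows "2 * (sqrt n * (S * (n\<^sup>2 * Lhat * (1 + sqrt 8 * n / \<epsilon>)) / \<gamma>)) \<le> sqrt Q"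
    and "8 * sqrt (2 * n * Lhat\<^sup>2 + 16 * n\<^sup>2 * Lhat\<^sup>2 / \<epsilon>\<^sup>2) \<le> sqrt Q"
proof -
  define q where "q = 32 * n ^ 3 * Lhat\<^sup>2 * (1 + 8 * n\<^sup>2 / \<epsilon>\<^sup>2)"
  have q0: "0 \<le> q" using pos by (simp add: q_def)
  have qQ: "q / (\<gamma> * (1 - lam))\<^sup>2 \<le> Q"
  proof -
    have "32 * n ^ 3 * Lhat\<^sup>2 / (\<gamma> * (1 - lam))\<^sup>2
        \<le> 8 * n ^ 3 * 2\<^sup>2 * Lhat\<^sup>2 / (\<gamma>\<^sup>2 * lam\<^sup>2 * (1 - lam)\<^sup>2)"
    proof (rule frac_le)
      have "lam\<^sup>2 \<le> 1" using pos by (simp add: power_le_one)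
      then have "(\<gamma>\<^sup>2 * (1 - lam)\<^sup>2) * lam\<^sup>2 \<le> (\<gamma>\<^sup>2 * (1 - lam)\<^sup>2) * 1" by (intro mult_left_mono) auto
      then show "\<gamma>\<^sup>2 * lam\<^sup>2 * (1 - lam)\<^sup>2 \<le> (\<gamma> * (1 - lam))\<^sup>2" by (simp add: power_mult_distrib mult_ac)
    qed (use pos in auto)
    moreover have "q = 32 * n ^ 3 * Lhat\<^sup>2 + 64 * n ^ 5 * 2\<^sup>2 * Lhat\<^sup>2 / \<epsilon>\<^sup>2"
      by (simp add: q_def distrib_left eval_nat_numeral)
    then have "q / (\<gamma> * (1 - lam))\<^sup>2 = 32 * n ^ 3 * Lhat\<^sup>2 / (\<gamma> * (1 - lam))\<^sup>2
        + 64 * n ^ 5 * 2\<^sup>2 * Lhat\<^sup>2 / (\<gamma>\<^sup>2 * (1 - lam)\<^sup>2 * \<epsilon>\<^sup>2)"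
      by (simp only: add_divide_distrib power_mult_distrib divide_divide_eq_left mult_ac)
    ultimately show ?thesis using Q by linarith
  qed
  show "2 * (sqrt n * (S * (n\<^sup>2 * Lhat * (1 + sqrt 8 * n / \<epsilon>)) / \<gamma>)) \<le> sqrt Q"
  proof (rule real_le_rsqrt)
    have sq: "(1 + sqrt 8 * n / \<epsilon>)\<^sup>2 \<le> 2 * (1 + 8 * n\<^sup>2 / \<epsilon>\<^sup>2)"
    proof -
      have "2 * 1 * (sqrt 8 * n / \<epsilon>) \<le> 1\<^sup>2 + (sqrt 8 * n / \<epsilon>)\<^sup>2" by (rule sum_squares_bound)
      moreover have "(sqrt 8 * n / \<epsilon>)\<^sup>2 = 8 * n\<^sup>2 / \<epsilon>\<^sup>2" by (simp add: power_divide power_mult_distrib)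
      ultimately show ?thesis by (simp add: power2_sum)
    qed
    have "S * n \<le> 2 / (1 - lam)" using S(2) pos by (simp add: field_simps)
    then have "(S * n)\<^sup>2 \<le> (2 / (1 - lam))\<^sup>2" using S pos by (intro power_mono) auto
    then have "S\<^sup>2 * n\<^sup>2 \<le> 4 / (1 - lam)\<^sup>2" by (simp add: power_divide power_mult_distrib)
    then have "S\<^sup>2 * n\<^sup>2 * (8 * n ^ 3 * Lhat\<^sup>2 * (1 + 8 * n\<^sup>2 / \<epsilon>\<^sup>2) / \<gamma>\<^sup>2)
        \<le> 4 / (1 - lam)\<^sup>2 * (8 * n ^ 3 * Lhat\<^sup>2 * (1 + 8 * n\<^sup>2 / \<epsilon>\<^sup>2) / \<gamma>\<^sup>2)"
      using pos by (intro mult_right_mono) auto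
    also have "\<dots> = q / (\<gamma> * (1 - lam))\<^sup>2" by (simp add: q_def power_mult_distrib mult_ac)
    finally have 1: "S\<^sup>2 * n\<^sup>2 * (8 * n ^ 3 * Lhat\<^sup>2 * (1 + 8 * n\<^sup>2 / \<epsilon>\<^sup>2) / \<gamma>\<^sup>2) \<le> Q" using qQ by simp
    have "(2 * (sqrt n * (S * (n\<^sup>2 * Lhat * (1 + sqrt 8 * n / \<epsilon>)) / \<gamma>)))\<^sup>2
        = (S\<^sup>2 * n\<^sup>2 * (4 * n ^ 3 * Lhat\<^sup>2 / \<gamma>\<^sup>2)) * (1 + sqrt 8 * n / \<epsilon>)\<^sup>2"
      using pos(1) by (simp add: power_mult_distrib power_divide eval_nat_numeral)
    also have "\<dots> \<le> (S\<^sup>2 * n\<^sup>2 * (4 * n ^ 3 * Lhat\<^sup>2 / \<gamma>\<^sup>2)) * (2 * (1 + 8 * n\<^sup>2 / \<epsilon>\<^sup>2))"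
      using sq pos by (intro mult_left_mono) auto
    also have "\<dots> = S\<^sup>2 * n\<^sup>2 * (8 * n ^ 3 * Lhat\<^sup>2 * (1 + 8 * n\<^sup>2 / \<epsilon>\<^sup>2) / \<gamma>\<^sup>2)" by simp
    also note 1
    finally show "(2 * (sqrt n * (S * (n\<^sup>2 * Lhat * (1 + sqrt 8 * n / \<epsilon>)) / \<gamma>)))\<^sup>2 \<le> Q" .
  qed
  show "8 * sqrt (2 * n * Lhat\<^sup>2 + 16 * n\<^sup>2 * Lhat\<^sup>2 / \<epsilon>\<^sup>2) \<le> sqrt Q"
  proof (rule real_le_rsqrt)
    let ?K = "2 * n * Lhat\<^sup>2 + 16 * n\<^sup>2 * Lhat\<^sup>2 / \<epsilon>\<^sup>2"
    have "2\<^sup>2 \<le> n\<^sup>2" using pos by (intro power_mono) auto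
    then have n2: "4 * n \<le> n\<^sup>2 * n" using pos by (intro mult_right_mono) auto
    have "n * 1 \<le> n * n" using pos by (intro mult_left_mono) auto
    then have "1 + 8 * n / \<epsilon>\<^sup>2 \<le> 1 + 8 * n\<^sup>2 / \<epsilon>\<^sup>2"
      using pos by (simp add: power2_eq_square divide_right_mono)
    then have "32 * Lhat\<^sup>2 * (4 * n) * (1 + 8 * n / \<epsilon>\<^sup>2) \<le> 32 * Lhat\<^sup>2 * (n\<^sup>2 * n) * (1 + 8 * n\<^sup>2 / \<epsilon>\<^sup>2)"
      using pos n2 by (intro mult_mono) auto
    moreover have "(8 * sqrt ?K)\<^sup>2 = 32 * Lhat\<^sup>2 * (4 * n) * (1 + 8 * n / \<epsilon>\<^sup>2)"
      using pos by (simp add: power_mult_distrib field_simps eval_nat_numeral)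
    moreover have "32 * Lhat\<^sup>2 * (n\<^sup>2 * n) * (1 + 8 * n\<^sup>2 / \<epsilon>\<^sup>2) = q"
      by (simp add: q_def eval_nat_numeral)
    moreover have "q \<le> q / (\<gamma> * (1 - lam))\<^sup>2"
    proof -
      have "\<gamma> * (1 - lam) \<le> 1 * 1" using pos by (intro mult_mono) auto
      then have "(\<gamma> * (1 - lam))\<^sup>2 \<le> 1" using pos by (simp add: power_le_one)
      then show ?thesis using q0 pos by (simp add: pos_le_divide_eq mult_left_le)
    qed
    ultimately show "(8 * sqrt ?K)\<^sup>2 \<le> Q" using qQ by linarith
  qed
qed

section \<open>The regret bound\<close>

theorem theorem5:
  fixes M :: "'a measure"
    and chi :: "real set"
    and X :: "(real ^ 'n::finite) set"
    and f :: "nat \<Rightarrow> 'a \<Rightarrow> real ^ 'n \<Rightarrow> real"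
    and df :: "nat \<Rightarrow> 'a \<Rightarrow> real ^ 'n \<Rightarrow> real ^ 'n"
    and psi :: "real ^ 'n \<Rightarrow> real"
    and E :: "nat \<Rightarrow> ('n \<times> 'n) set"
    and xi u x :: "nat \<Rightarrow> 'a \<Rightarrow> real ^ 'n"
    and eta z h y :: "nat \<Rightarrow> 'a \<Rightarrow> real ^ 'n ^ 'n"
    and w :: "nat \<Rightarrow> real ^ 'n"
    and B T :: nat
    and R :: "(((nat \<Rightarrow> real ^ 'n \<Rightarrow> real) \<times> (nat \<Rightarrow> real ^ 'n ^ 'n)) \<times>
               ((nat \<Rightarrow> real ^ 'n \<Rightarrow> real) \<times> (nat \<Rightarrow> real ^ 'n ^ 'n))) set"
    and \<epsilon> C L G Lhat n D \<beta> \<gamma> lam M2 :: real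
  assumes prob: "prob_space M"
    and n: "n = real CARD('n)" "CARD('n) \<ge> 2"
    and X: "X = cart_power chi"
    and network: "B_strongly_connected B E"
    and pos: "\<epsilon> > 0" "C > 0" "L > 0" "G > 0" "Lhat > 0"
    \<comment> \<open>the losses and their gradients\<close>
    and f_integrable: "\<And>t v. v \<in> X \<Longrightarrow> integrable M (\<lambda>\<omega>. f t \<omega> v)"
    and gradient: "\<And>t \<omega>. \<omega> \<in> space M \<Longrightarrow> gradient_on X (f t \<omega>) (df t \<omega>)"
    and a: "\<And>t \<omega>. \<omega> \<in> space M \<Longrightarrow> convex_on X (f t \<omega>)"
    \<comment> \<open>the proximal function\<close>
    and psi: "\<And>v. v \<in> X \<Longrightarrow> 0 \<le> psi v" "strongly_convex_on 1 X psi"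
    and b: "\<And>v. v \<in> X \<Longrightarrow> psi v \<le> C"
    and c: "X \<noteq> {}" "convex X" "closed X" "bounded chi"
    and d: "\<And>t \<omega> v. \<omega> \<in> space M \<Longrightarrow> v \<in> X \<Longrightarrow> norm (df t \<omega> v) \<le> L"
    and e: "\<And>t \<omega> v v'. \<omega> \<in> space M \<Longrightarrow> v \<in> X \<Longrightarrow> v' \<in> X \<Longrightarrow>
              norm (df t \<omega> v - df t \<omega> v') \<le> G * norm (v - v')"
    \<comment> \<open>the algorithm\<close>
    and random_vars:
      "\<And>t. xi t \<in> borel_measurable M" "\<And>t. eta t \<in> borel_measurable M"
      "\<And>t. u t \<in> borel_measurable M" "\<And>t. z t \<in> borel_measurable M"
      "\<And>t. h t \<in> borel_measurable M" "\<And>t. y t \<in> borel_measurable M"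
    and algorithm: "\<And>\<omega>. \<omega> \<in> space M \<Longrightarrow>
      dpsda_ps_run X psi E (\<lambda>t. df t \<omega>) (\<lambda>t. xi t \<omega>) (\<lambda>t. eta t \<omega>)
        (\<lambda>t. z t \<omega>) (\<lambda>t. h t \<omega>) w (\<lambda>t. u t \<omega>) (\<lambda>t. y t \<omega>) (\<lambda>t. x t \<omega>)"
    \<comment> \<open>the privacy noise; fresh noise is independent of the past and of the current gradients\<close>
    and sens: "R \<subseteq> run_pairs X psi E" "\<And>t. sensitivity R t \<le> ennreal (2 * n * Lhat)"
    and noise: "\<And>t i k. laplace_distributed M (\<lambda>\<omega>. eta t \<omega> $ i $ k)
                          (enn2real (sensitivity R t) / \<epsilon>)"
    and noise_indep:
      "prob_space.indep_vars M (\<lambda>_. borel) (\<lambda>(t, i, k) \<omega>. eta t \<omega> $ i $ k)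
         (UNIV :: (nat \<times> 'n \<times> 'n) set)"
      "\<And>t. prob_space.indep_set M (preimages M (eta t))
              (sigma_sets (space M) (sets (history M z h u y t) \<union> preimages M (u t)))"
    \<comment> \<open>the stochastic gradients\<close>
    and S_mean: "\<And>t i. AE \<omega> in M.
      real_cond_exp M (history M z h u y t) (\<lambda>\<omega>. u t \<omega> $ i) \<omega> = df t \<omega> (y t \<omega> $ i) \<bullet> axis i 1"
    and S_moment: "\<And>t i. AE \<omega> in M.
      nn_cond_exp M (history M z h u y t) (\<lambda>\<omega>. ennreal (\<bar>u t \<omega> $ i\<bar>\<^sup>2)) \<omega> \<le> ennreal (Lhat\<^sup>2)"
    \<comment> \<open>the constants\<close>
    and D: "D = (SUP (r, s)\<in>chi \<times> chi. \<bar>r - s\<bar>)"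
    and \<gamma>: "\<gamma> = (INF t. MIN i. (mat_prod (\<lambda>t. weight_mat (E t)) t 0 *v 1) $ i)"
    and \<beta>: "\<beta> = 2"
    and lam: "lam = (1 - 1 / n ^ (CARD('n) * B)) powr (1 / real B)"
    and M2: "M2 = 16 * n\<^sup>2 * Lhat\<^sup>2 / \<epsilon>\<^sup>2 + 2 * n * Lhat\<^sup>2 + C
      + 2 * (L + sqrt n * D * G)
          * sqrt (8 * n ^ 3 * \<beta>\<^sup>2 * Lhat\<^sup>2 / (\<gamma>\<^sup>2 * lam\<^sup>2 * (1 - lam)\<^sup>2)
                  + 64 * n ^ 5 * \<beta>\<^sup>2 * Lhat\<^sup>2 / (\<gamma>\<^sup>2 * (1 - lam)\<^sup>2 * \<epsilon>\<^sup>2))"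
    and T: "T \<ge> 1"
  shows "pseudo_regret M X f x T \<le> M2 * sqrt (real T)"
proof -
  interpret prob_space M by (rule prob)
  interpret connected_network B E by unfold_locales (rule network)
  note diam = cart_power_diameter[OF X c(1,4) D]
  interpret prox_function X psi
    by unfold_locales (use c psi diam in auto)
  have run: "dpsda_run X psi B E (\<lambda>t. df t \<omega>) (\<lambda>t. xi t \<omega>) (\<lambda>t. u t \<omega>) (\<lambda>t. x t \<omega>) w
      (\<lambda>t. eta t \<omega>) (\<lambda>t. z t \<omega>) (\<lambda>t. h t \<omega>) (\<lambda>t. y t \<omega>)" if "\<omega> \<in> space M" for \<omega>
    by unfold_locales (use algorithm[OF that] n in auto)
  note [measurable] = random_vars
  have n2: "2 \<le> n" using n by simp

  \<comment> \<open>The constants of the bound\<close>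
  define S where "S = real (CARD('n) * B) / (1 - mixing_rate CARD('n) B)"
  define K where "K = 2 * n * Lhat\<^sup>2 + 16 * n\<^sup>2 * Lhat\<^sup>2 / \<epsilon>\<^sup>2"
  define Q where "Q = 8 * n ^ 3 * \<beta>\<^sup>2 * Lhat\<^sup>2 / (\<gamma>\<^sup>2 * lam\<^sup>2 * (1 - lam)\<^sup>2)
                  + 64 * n ^ 5 * \<beta>\<^sup>2 * Lhat\<^sup>2 / (\<gamma>\<^sup>2 * (1 - lam)\<^sup>2 * \<epsilon>\<^sup>2)"
  \<comment> \<open>Bounds the expected \<open>input_size\<close>: there are \<open>n\<close> nodes,
    each with \<open>n * Lhat\<close> from the gradient and \<open>n\<close> noise entries of mean
    size at most \<open>sqrt 8 * n * Lhat / \<epsilon>\<close>.\<close>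
  define r where "r = n\<^sup>2 * Lhat * (1 + sqrt 8 * n / \<epsilon>)"
  have M2_eq: "M2 = K + C + 2 * (L + sqrt n * D * G) * sqrt Q"
    by (simp add: M2 K_def Q_def)
  note wb = weight_bounds[OF \<gamma>]
  note gap = spectral_gap_le[OF n(2) B_pos lam[unfolded n(1)]]
  have S0: "0 \<le> S" using mixing_rate_less_1 by (simp add: S_def)
  have S_le: "S \<le> 2 / (n * (1 - lam))" using gap(3) by (simp add: S_def n(1))
  have r0: "0 \<le> r" using n2 pos by (simp add: r_def)
  have K0: "0 \<le> K" using n2 by (simp add: K_def)
  have netQ: "2 * (sqrt n * (S * r / \<gamma>)) \<le> sqrt Q" and KQ: "8 * sqrt K \<le> sqrt Q"
    using network_constant[OF n2 pos(5,1) wb(1,2) gap(1,2) S0 S_le Q_def[unfolded \<beta>]]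
    by (simp_all add: K_def r_def)
  define c1 where "c1 = sqrt n * (L + sqrt n * D * G)"
  have LDG: "L \<le> L + sqrt n * D * G" using diam(2) pos n2 by simp
  then have c1: "0 \<le> c1" using pos n2 by (simp add: c1_def)
  have M2_ge: "C \<le> M2"
  proof -
    have "0 \<le> sqrt Q" using KQ K0 by (meson order_trans mult_nonneg_nonneg real_sqrt_ge_zero zero_le_numeral)
    then have "0 \<le> 2 * (L + sqrt n * D * G) * sqrt Q" using LDG pos by simp
    then show ?thesis using K0 M2_eq by linarith
  qed

  \<comment> \<open>The centralised process as random variables\<close>
  define g where "g t \<omega> = avg_input (u t \<omega>) (eta t \<omega>)" for t \<omega>
  define m where "m t \<omega> = prox (step_size t) (\<Sum>s<Suc t. g s \<omega>)" for t \<omega>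
  define W where "W t \<omega> = disagreement B (\<lambda>s. u s \<omega>) (\<lambda>s. eta s \<omega>) t" for t \<omega>
  \<comment> \<open>Coordinate \<open>k\<close> belongs to the exact gradient at
    \<open>y t $ k\<close>, so \<open>p\<close> is in general not the gradient at a single
    point.\<close>
  define p where "p t \<omega> = u t \<omega> - xi t \<omega>" for t \<omega>
  define H where "H t = history M z h u y t" for t
  have H: "subalgebra M (H t)" for t
    unfolding H_def by (rule subalgebra_history[OF random_vars(4,5,3,6)])
  have m_eq: "dpsda_run.mean_iterate X psi (\<lambda>t. u t \<omega>) (\<lambda>t. eta t \<omega>) t = m t \<omega>"
    if "\<omega> \<in> space M" for t \<omega>
    using dpsda_run.mean_iterate_def[OF run[OF that]] dpsda_run.dual_avg_def[OF run[OF that]]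
    by (simp add: m_def g_def)
  have mX: "m t \<omega> \<in> X" for t \<omega> unfolding m_def by (rule prox(1)[OF step_size_pos])
  have xX: "x (Suc t) \<omega> \<in> X" if "\<omega> \<in> space M" for t \<omega>
  proof -
    have "y (Suc t) \<omega> $ i \<in> X" "x (Suc t) \<omega> $ i = y (Suc t) \<omega> $ i $ i" for i
      using algorithm[OF that] by (auto simp: dpsda_ps_run_def is_prox_def is_arg_min_def)
    then show ?thesis by (simp add: X cart_power_def)
  qed
  have dist_le: "norm (v - v') \<le> sqrt n * D" if "v \<in> X" "v' \<in> X" for v v'
    unfolding n(1) using diam(1)[OF that] by (intro norm_le_sqrt_CARD) simp

  \<comment> \<open>The history is generated by \<open>z\<close>, \<open>h\<close>, \<open>u\<close>
    and \<open>y\<close>, so the noise is recovered from it as \<open>h - z\<close>.\<close>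
  have m_hist: "m t \<in> borel_measurable (H (Suc t))" for t
  proof -
    have "(\<lambda>\<omega>. avg_input (u s \<omega>) (h s \<omega> - z s \<omega>)) \<in> borel_measurable (H (Suc t))" if "s < Suc t" for s
      using borel_measurable_history[OF that, where M = M and z = z and h = h and u = u and y = y, folded H_def] by measurable
    then have "(\<lambda>\<omega>. \<Sum>s<Suc t. avg_input (u s \<omega>) (h s \<omega> - z s \<omega>)) \<in> borel_measurable (H (Suc t))"
      by (intro borel_measurable_sum) auto
    moreover have "(\<Sum>s<Suc t. avg_input (u s \<omega>) (h s \<omega> - z s \<omega>)) = (\<Sum>s<Suc t. g s \<omega>)"
      if "\<omega> \<in> space (H (Suc t))" for \<omega>
    proof -
      have "\<omega> \<in> space M" using that H by (simp add: subalgebra_def)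
      then have "h s \<omega> - z s \<omega> = eta s \<omega>" for s
        using algorithm[of \<omega>] by (simp add: dpsda_ps_run_def vec_eq_iff)
      then show ?thesis by (simp add: g_def)
    qed
    ultimately have "(\<lambda>\<omega>. \<Sum>s<Suc t. g s \<omega>) \<in> borel_measurable (H (Suc t))"
      by (subst (asm) measurable_cong) auto
    then show ?thesis
      unfolding m_def by (rule borel_measurable_continuous_on[OF continuous_on_prox[OF step_size_pos]])
  qed
  have m_meas[measurable]: "m t \<in> borel_measurable M" for t
    by (rule measurable_from_subalg[OF H m_hist])
  have g_meas[measurable]: "g t \<in> borel_measurable M" for t
    unfolding g_def by measurable
  have p_meas[measurable]: "p t \<in> borel_measurable M" for t
    unfolding p_def by measurable
  \<comment> \<open>The decisions are assembled from the diagonal entries of \<open>y\<close>. Since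
    \<open>x 0\<close> is arbitrary, only times \<open>Suc t\<close> are covered.\<close>
  have x_meas[measurable]: "x (Suc t) \<in> borel_measurable M" for t
  proof -
    have "(\<lambda>\<omega>. \<chi> i. y (Suc t) \<omega> $ i $ i) \<in> borel_measurable M"
      by (intro borel_measurable_vec_lambda) measurable
    moreover have "x (Suc t) \<omega> = (\<chi> i. y (Suc t) \<omega> $ i $ i)" if "\<omega> \<in> space M" for \<omega>
      using algorithm[OF that] by (simp add: dpsda_ps_run_def vec_eq_iff)
    ultimately show ?thesis by (subst measurable_cong) auto
  qed

  \<comment> \<open>Moments of the gradients and the noise\<close>
  define \<sigma> where "\<sigma> t = enn2real (sensitivity R t) / \<epsilon>" for t
  \<comment> \<open>The scale is at most \<open>2 * n * Lhat / \<epsilon>\<close> and the Laplace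
    variance is \<open>2 * (\<sigma> t) ^ 2\<close>, whence the \<open>sqrt 8\<close>.\<close>
  have \<sigma>: "0 \<le> \<sigma> t" "2 * (\<sigma> t)\<^sup>2 \<le> (sqrt 8 * n * Lhat / \<epsilon>)\<^sup>2" for t
  proof -
    have "enn2real (sensitivity R t) \<le> 2 * n * Lhat"
      using sens(2)[of t] n2 pos by (intro enn2real_leI) auto
    then have "\<sigma> t \<le> 2 * n * Lhat / \<epsilon>" using pos by (simp add: \<sigma>_def divide_right_mono)
    moreover show "0 \<le> \<sigma> t" using pos by (simp add: \<sigma>_def)
    ultimately have "(\<sigma> t)\<^sup>2 \<le> (2 * n * Lhat / \<epsilon>)\<^sup>2" by (intro power_mono)
    then show "2 * (\<sigma> t)\<^sup>2 \<le> (sqrt 8 * n * Lhat / \<epsilon>)\<^sup>2"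
      by (simp add: power_mult_distrib power_divide)
  qed
  note eta_mom = laplace_moments[OF noise[folded \<sigma>_def] \<sigma>(1)]
  have eta_abs: "expectation (\<lambda>\<omega>. \<bar>eta t \<omega> $ i $ k\<bar>) \<le> sqrt 8 * n * Lhat / \<epsilon>" for t i k
    by (rule expectation_abs_le(2)[OF _ eta_mom(3)]) (use eta_mom(4) \<sigma>(2) n2 pos in auto)
  note u_mom = conditional_second_moment[OF H _ S_moment[folded H_def]]
  have u_sq: "integrable M (\<lambda>\<omega>. (u t \<omega> $ i)\<^sup>2)" "expectation (\<lambda>\<omega>. (u t \<omega> $ i)\<^sup>2) \<le> Lhat\<^sup>2" for t i
    by (intro u_mom; measurable)+
  have u_int: "integrable M (\<lambda>\<omega>. u t \<omega> $ i)" and u_abs: "expectation (\<lambda>\<omega>. \<bar>u t \<omega> $ i\<bar>) \<le> Lhat" for t i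
    by (rule expectation_abs_le[OF _ u_sq]; use pos in simp)+

  have size_int: "integrable M (\<lambda>\<omega>. input_size (u t \<omega>) (eta t \<omega>))" for t
    unfolding input_size_def using u_int eta_mom(1) by auto
  have size_le: "expectation (\<lambda>\<omega>. input_size (u t \<omega>) (eta t \<omega>)) \<le> r" for t
  proof -
    have "expectation (\<lambda>\<omega>. input_size (u t \<omega>) (eta t \<omega>))
        = (\<Sum>j\<in>UNIV. n * expectation (\<lambda>\<omega>. \<bar>u t \<omega> $ j\<bar>) + (\<Sum>k\<in>UNIV. expectation (\<lambda>\<omega>. \<bar>eta t \<omega> $ j $ k\<bar>)))"
      unfolding input_size_def n(1) using u_int eta_mom(1) by simp
    also have "\<dots> \<le> (\<Sum>j\<in>(UNIV :: 'n set). n * Lhat + (\<Sum>k\<in>(UNIV :: 'n set). sqrt 8 * n * Lhat / \<epsilon>))"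
      using u_abs eta_abs n2 by (intro sum_mono add_mono mult_left_mono) auto
    also have "\<dots> = r" by (simp add: r_def n(1) power2_eq_square algebra_simps)
    finally show ?thesis .
  qed
  have W_int: "integrable M (W t)" for t
    unfolding W_def disagreement_def using size_int by auto
  have W_le: "expectation (W t) \<le> S * r" for t
  proof -
    have "expectation (W t) = (\<Sum>s<t. mixing_rate CARD('n) B ^ ((t - Suc s) div (CARD('n) * B))
        * expectation (\<lambda>\<omega>. input_size (u s \<omega>) (eta s \<omega>)))"
      unfolding W_def disagreement_def using size_int by simp
    also have "\<dots> \<le> (\<Sum>s<t. mixing_rate CARD('n) B ^ ((t - Suc s) div (CARD('n) * B)) * r)"
      using size_le mixing_rate_nonneg[OF n(2)] by (intro sum_mono mult_left_mono) auto
    also have "\<dots> \<le> S * r"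
      unfolding sum_distrib_right[symmetric] S_def
      using sum_mixing_rate_le[OF n(2)] r0 by (rule mult_right_mono)
    finally show ?thesis .
  qed

  \<comment> \<open>Independence over the nodes makes the variance of the sum grow like
    \<open>n\<close> rather than \<open>n ^ 2\<close>. After averaging, the noise of all
    \<open>n\<close> coordinates together has second moment only
    \<open>2 * (\<sigma> t) ^ 2\<close>.\<close>
  have noise_sum: "integrable M (\<lambda>\<omega>. (\<Sum>j\<in>UNIV. eta t \<omega> $ j $ k)\<^sup>2)"
    "expectation (\<lambda>\<omega>. (\<Sum>j\<in>UNIV. eta t \<omega> $ j $ k)\<^sup>2) = n * (2 * (\<sigma> t)\<^sup>2)" for t k
  proof -
    let ?I = "(\<lambda>j. (t, j, k)) ` (UNIV :: 'n set)" and ?N = "\<lambda>(t, i, k) \<omega>. eta t \<omega> $ i $ k"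
    have indep: "indep_vars (\<lambda>_. borel) ?N ?I"
      by (rule indep_vars_subset[OF noise_indep(1)]) simp
    have inj: "inj (\<lambda>j. (t, j, k))" by (simp add: inj_on_def)
    note N = expectation_sum_squared_indep[OF _ indep]
    have "integrable M (\<lambda>\<omega>. (\<Sum>q\<in>?I. ?N q \<omega>)\<^sup>2)"
      "expectation (\<lambda>\<omega>. (\<Sum>q\<in>?I. ?N q \<omega>)\<^sup>2) = (\<Sum>q\<in>?I. expectation (\<lambda>\<omega>. (?N q \<omega>)\<^sup>2))"
      by (rule N; use eta_mom in auto)+
    then show "integrable M (\<lambda>\<omega>. (\<Sum>j\<in>UNIV. eta t \<omega> $ j $ k)\<^sup>2)"
      "expectation (\<lambda>\<omega>. (\<Sum>j\<in>UNIV. eta t \<omega> $ j $ k)\<^sup>2) = n * (2 * (\<sigma> t)\<^sup>2)"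
      by (simp_all add: sum.reindex[OF inj] o_def eta_mom(4) n(1))
  qed
  have g_nth: "g t \<omega> $ k = u t \<omega> $ k + (1 / n) * (\<Sum>j\<in>UNIV. eta t \<omega> $ j $ k)" for t \<omega> k
    by (simp add: g_def avg_input_def n(1))
  \<comment> \<open>The factor 2 of \<open>(a + b) ^ 2 \<le> 2 * a ^ 2 + 2 * b ^ 2\<close> replaces
    an estimate of the mixed term between gradient and noise; it gives the two summands of
    \<open>K\<close>.\<close>
  have g_norm: "(norm (g t \<omega>))\<^sup>2
      \<le> (\<Sum>k\<in>UNIV. 2 * (u t \<omega> $ k)\<^sup>2 + 2 / n\<^sup>2 * (\<Sum>j\<in>UNIV. eta t \<omega> $ j $ k)\<^sup>2)" for t \<omega>
  proof -
    have "(norm (g t \<omega>))\<^sup>2 = (\<Sum>k\<in>UNIV. (g t \<omega> $ k)\<^sup>2)"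
      unfolding power2_norm_eq_inner inner_vec_def by (simp only: inner_real_def power2_eq_square)
    also have "\<dots> \<le> (\<Sum>k\<in>UNIV. 2 * (u t \<omega> $ k)\<^sup>2 + 2 / n\<^sup>2 * (\<Sum>j\<in>UNIV. eta t \<omega> $ j $ k)\<^sup>2)"
    proof (rule sum_mono)
      fix k
      have sq: "(a + b)\<^sup>2 \<le> 2 * a\<^sup>2 + 2 * b\<^sup>2" for a b :: real
        using sum_squares_bound[of a b] by (simp add: power2_sum)
      show "(g t \<omega> $ k)\<^sup>2 \<le> 2 * (u t \<omega> $ k)\<^sup>2 + 2 / n\<^sup>2 * (\<Sum>j\<in>UNIV. eta t \<omega> $ j $ k)\<^sup>2"
        unfolding g_nth using sq[of "u t \<omega> $ k" "(1 / n) * (\<Sum>j\<in>UNIV. eta t \<omega> $ j $ k)"]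
        by (simp add: power_mult_distrib power_divide)
    qed
    finally show ?thesis .
  qed
  have g_sq_int: "integrable M (\<lambda>\<omega>. (norm (g t \<omega>))\<^sup>2)" for t
  proof (rule Bochner_Integration.integrable_bound)
    show "integrable M (\<lambda>\<omega>. \<Sum>k\<in>UNIV. 2 * (u t \<omega> $ k)\<^sup>2 + 2 / n\<^sup>2 * (\<Sum>j\<in>UNIV. eta t \<omega> $ j $ k)\<^sup>2)"
      using u_sq(1) noise_sum(1)
      by (intro Bochner_Integration.integrable_sum Bochner_Integration.integrable_add integrable_mult_right) auto
    show "AE \<omega> in M. norm ((norm (g t \<omega>))\<^sup>2)
        \<le> norm (\<Sum>k\<in>UNIV. 2 * (u t \<omega> $ k)\<^sup>2 + 2 / n\<^sup>2 * (\<Sum>j\<in>UNIV. eta t \<omega> $ j $ k)\<^sup>2)"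
    proof (rule AE_I2)
      fix \<omega>
      show "norm ((norm (g t \<omega>))\<^sup>2)
        \<le> norm (\<Sum>k\<in>UNIV. 2 * (u t \<omega> $ k)\<^sup>2 + 2 / n\<^sup>2 * (\<Sum>j\<in>UNIV. eta t \<omega> $ j $ k)\<^sup>2)"
        using order_trans[OF g_norm abs_ge_self] by (simp only: real_norm_def abs_power2)
    qed
  qed measurable
  have g_sq_le: "expectation (\<lambda>\<omega>. (norm (g t \<omega>))\<^sup>2) \<le> K" for t
  proof -
    have int: "integrable M (\<lambda>\<omega>. 2 * (u t \<omega> $ k)\<^sup>2)" "integrable M (\<lambda>\<omega>. 2 / n\<^sup>2 * (\<Sum>j\<in>UNIV. eta t \<omega> $ j $ k)\<^sup>2)" for k
      using u_sq(1) noise_sum(1) by (intro integrable_mult_right; simp)+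
    have "expectation (\<lambda>\<omega>. (norm (g t \<omega>))\<^sup>2)
        \<le> expectation (\<lambda>\<omega>. \<Sum>k\<in>UNIV. 2 * (u t \<omega> $ k)\<^sup>2 + 2 / n\<^sup>2 * (\<Sum>j\<in>UNIV. eta t \<omega> $ j $ k)\<^sup>2)"
      using int g_norm by (intro integral_mono g_sq_int Bochner_Integration.integrable_sum Bochner_Integration.integrable_add) auto
    also have "\<dots> = (\<Sum>k\<in>UNIV. expectation (\<lambda>\<omega>. 2 * (u t \<omega> $ k)\<^sup>2)
        + expectation (\<lambda>\<omega>. 2 / n\<^sup>2 * (\<Sum>j\<in>UNIV. eta t \<omega> $ j $ k)\<^sup>2))"
      using int by (subst Bochner_Integration.integral_sum) (auto intro!: sum.cong Bochner_Integration.integral_add)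
    also have "\<dots> \<le> (\<Sum>k\<in>(UNIV :: 'n set). 2 * Lhat\<^sup>2 + 2 / n\<^sup>2 * (n * (sqrt 8 * n * Lhat / \<epsilon>)\<^sup>2))"
    proof (rule sum_mono)
      fix k
      have "expectation (\<lambda>\<omega>. 2 / n\<^sup>2 * (\<Sum>j\<in>UNIV. eta t \<omega> $ j $ k)\<^sup>2) = 2 / n\<^sup>2 * (n * (2 * (\<sigma> t)\<^sup>2))"
        by (simp only: integral_mult_right_zero noise_sum(2))
      also have "\<dots> \<le> 2 / n\<^sup>2 * (n * (sqrt 8 * n * Lhat / \<epsilon>)\<^sup>2)"
        using \<sigma>(2)[of t] n2 by (intro mult_left_mono) auto
      finally show "expectation (\<lambda>\<omega>. 2 * (u t \<omega> $ k)\<^sup>2) + expectation (\<lambda>\<omega>. 2 / n\<^sup>2 * (\<Sum>j\<in>UNIV. eta t \<omega> $ j $ k)\<^sup>2)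
          \<le> 2 * Lhat\<^sup>2 + 2 / n\<^sup>2 * (n * (sqrt 8 * n * Lhat / \<epsilon>)\<^sup>2)"
        using u_sq(2)[of t k] by (intro add_mono) auto
    qed
    also have "\<dots> = n * (2 * Lhat\<^sup>2 + 2 / n\<^sup>2 * (n * (sqrt 8 * n * Lhat / \<epsilon>)\<^sup>2))"
      by (simp add: n(1))
    also have "\<dots> = K"
      using n2 by (simp add: K_def field_simps power2_eq_square)
    finally show ?thesis .
  qed
  have g_norm_int: "integrable M (\<lambda>\<omega>. norm (g t \<omega>))" and g_norm_le: "expectation (\<lambda>\<omega>. norm (g t \<omega>)) \<le> sqrt K" for t
    using expectation_abs_le[of "\<lambda>\<omega>. norm (g t \<omega>)" "sqrt K"] g_sq_int g_sq_le K0 by auto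

  \<comment> \<open>Exchanging exact gradients and noisy inputs in expectation\<close>
  have unbiased: "integrable M (\<lambda>\<omega>. p (Suc t) \<omega> \<bullet> (m t \<omega> - v))" (is ?int1)
    "integrable M (\<lambda>\<omega>. g (Suc t) \<omega> \<bullet> (m t \<omega> - v))" (is ?int2)
    "expectation (\<lambda>\<omega>. p (Suc t) \<omega> \<bullet> (m t \<omega> - v)) = expectation (\<lambda>\<omega>. g (Suc t) \<omega> \<bullet> (m t \<omega> - v))" (is ?eq)
    if v: "v \<in> X" for t v
  proof -
    \<comment> \<open>\<open>m t\<close> is determined by the inputs up to time \<open>t\<close>, so
      \<open>\<phi> k\<close> is known before time \<open>Suc t\<close>: conditioning turns
      \<open>u\<close> into \<open>p\<close>, and the fresh independent noise has mean zero against
      it.\<close>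
    define \<phi> where "\<phi> k \<omega> = m t \<omega> $ k - v $ k" for k \<omega>
    have \<phi>H: "\<phi> k \<in> borel_measurable (H (Suc t))" for k
      unfolding \<phi>_def using m_hist[of t] by measurable
    then have \<phi>M: "\<phi> k \<in> borel_measurable M" for k by (rule measurable_from_subalg[OF H])
    have \<phi>D: "\<bar>\<phi> k \<omega>\<bar> \<le> D" for k \<omega> unfolding \<phi>_def by (rule diam(1)[OF mX v])
    have \<phi>int: "integrable M (\<phi> k)" for k
      by (rule integrable_const_bound[OF _ \<phi>M, of _ D]) (simp add: \<phi>D)
    have pk: "integrable M (\<lambda>\<omega>. p (Suc t) \<omega> $ k * \<phi> k \<omega>)"
      "expectation (\<lambda>\<omega>. u (Suc t) \<omega> $ k * \<phi> k \<omega>) = expectation (\<lambda>\<omega>. p (Suc t) \<omega> $ k * \<phi> k \<omega>)" for k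
    proof -
      have "AE \<omega> in M. df (Suc t) \<omega> (y (Suc t) \<omega> $ k) \<bullet> axis k 1 = p (Suc t) \<omega> $ k"
        using algorithm by (intro AE_I2) (simp add: p_def dpsda_ps_run_def)
      then have ae: "AE \<omega> in M. real_cond_exp M (H (Suc t)) (\<lambda>\<omega>. u (Suc t) \<omega> $ k) \<omega> = p (Suc t) \<omega> $ k"
        using S_mean[of "Suc t" k, folded H_def] by eventually_elim simp
      have pm: "(\<lambda>\<omega>. p (Suc t) \<omega> $ k) \<in> borel_measurable M" by measurable
      show "integrable M (\<lambda>\<omega>. p (Suc t) \<omega> $ k * \<phi> k \<omega>)"
        "expectation (\<lambda>\<omega>. u (Suc t) \<omega> $ k * \<phi> k \<omega>) = expectation (\<lambda>\<omega>. p (Suc t) \<omega> $ k * \<phi> k \<omega>)"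
        by (rule expectation_mult_cond_exp[OF H u_int \<phi>H \<phi>D pm ae])+
    qed
    have uk: "integrable M (\<lambda>\<omega>. u (Suc t) \<omega> $ k * \<phi> k \<omega>)" for k
      by (rule integrable_mult_bounded[OF u_int \<phi>M \<phi>D])
    have ek: "integrable M (\<lambda>\<omega>. eta (Suc t) \<omega> $ j $ k * \<phi> k \<omega>)"
      "expectation (\<lambda>\<omega>. eta (Suc t) \<omega> $ j $ k * \<phi> k \<omega>) = 0" for j k
    proof -
      have "sets (H (Suc t)) \<subseteq> sigma_sets (space M) (sets (H (Suc t)) \<union> preimages M (u (Suc t)))"
        by auto
      note e = expectation_indep_mult_0[where g = "\<lambda>q. q $ j $ k" and N = "\<lambda>\<omega>. eta (Suc t) \<omega> $ j $ k",
          OF H noise_indep(2)[of "Suc t", folded H_def] this _ _ eta_mom(1,2) \<phi>H \<phi>int]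
      show "integrable M (\<lambda>\<omega>. eta (Suc t) \<omega> $ j $ k * \<phi> k \<omega>)"
        "expectation (\<lambda>\<omega>. eta (Suc t) \<omega> $ j $ k * \<phi> k \<omega>) = 0"
        by (rule e; (rule refl | measurable))+
    qed
    have p_eq: "p (Suc t) \<omega> \<bullet> (m t \<omega> - v) = (\<Sum>k\<in>UNIV. p (Suc t) \<omega> $ k * \<phi> k \<omega>)" for \<omega>
      by (simp add: inner_vec_def \<phi>_def)
    have g_eq: "g (Suc t) \<omega> \<bullet> (m t \<omega> - v)
        = (\<Sum>k\<in>UNIV. u (Suc t) \<omega> $ k * \<phi> k \<omega> + (1 / n) * (\<Sum>j\<in>UNIV. eta (Suc t) \<omega> $ j $ k * \<phi> k \<omega>))" for \<omega>
      by (simp add: inner_vec_def \<phi>_def g_nth distrib_right sum_distrib_right)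
    have int: "integrable M (\<lambda>\<omega>. u (Suc t) \<omega> $ k * \<phi> k \<omega> + (1 / n) * (\<Sum>j\<in>UNIV. eta (Suc t) \<omega> $ j $ k * \<phi> k \<omega>))" for k
      by (intro Bochner_Integration.integrable_add integrable_mult_right Bochner_Integration.integrable_sum uk ek(1))
    show ?int1 unfolding p_eq by (intro Bochner_Integration.integrable_sum pk(1))
    show ?int2 unfolding g_eq by (intro Bochner_Integration.integrable_sum int)
    have "expectation (\<lambda>\<omega>. g (Suc t) \<omega> \<bullet> (m t \<omega> - v)) = (\<Sum>k\<in>UNIV. expectation
        (\<lambda>\<omega>. u (Suc t) \<omega> $ k * \<phi> k \<omega> + (1 / n) * (\<Sum>j\<in>UNIV. eta (Suc t) \<omega> $ j $ k * \<phi> k \<omega>)))"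
      unfolding g_eq by (rule Bochner_Integration.integral_sum[OF int])
    also have "\<dots> = (\<Sum>k\<in>UNIV. expectation (\<lambda>\<omega>. p (Suc t) \<omega> $ k * \<phi> k \<omega>))"
    proof (rule sum.cong[OF refl])
      fix k
      have "expectation (\<lambda>\<omega>. (1 / n) * (\<Sum>j\<in>UNIV. eta (Suc t) \<omega> $ j $ k * \<phi> k \<omega>)) = 0"
        unfolding integral_mult_right_zero by (subst Bochner_Integration.integral_sum[OF ek(1)]) (simp add: ek(2))
      then show "expectation (\<lambda>\<omega>. u (Suc t) \<omega> $ k * \<phi> k \<omega> + (1 / n) * (\<Sum>j\<in>UNIV. eta (Suc t) \<omega> $ j $ k * \<phi> k \<omega>))
          = expectation (\<lambda>\<omega>. p (Suc t) \<omega> $ k * \<phi> k \<omega>)"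
        by (subst Bochner_Integration.integral_add[OF uk integrable_mult_right[OF Bochner_Integration.integrable_sum[OF ek(1)]]])
          (simp add: pk(2))
    qed
    also have "\<dots> = expectation (\<lambda>\<omega>. p (Suc t) \<omega> \<bullet> (m t \<omega> - v))"
      unfolding p_eq by (rule Bochner_Integration.integral_sum[OF pk(1), symmetric])
    finally show ?eq by simp
  qed

  \<comment> \<open>Integrability of the realised losses\<close>
  have lipschitz: "f t \<omega> v - f t \<omega> v' \<le> L * (sqrt n * D)"
    if "\<omega> \<in> space M" "v \<in> X" "v' \<in> X" for t \<omega> v v'
  proof -
    have "f t \<omega> v - f t \<omega> v' \<le> L * norm (v - v')"
      by (rule convex_on_gradient_bounded_imp_le[OF a gradient that(2,3) d]) (use that in auto)
    also have "\<dots> \<le> L * (sqrt n * D)" using dist_le[OF that(2,3)] pos by (intro mult_left_mono) auto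
    finally show ?thesis .
  qed
  have fx_int: "integrable M (\<lambda>\<omega>. f (Suc t) \<omega> (x (Suc t) \<omega>))" for t
  proof -
    obtain v where v: "v \<in> X" using c(1) by blast
    have cont: "continuous_on X (f (Suc t) \<omega>)" if "\<omega> \<in> space M" for \<omega>
      using gradient[OF that, of "Suc t"] unfolding gradient_on_def continuous_on_eq_continuous_within
      by (blast intro: has_derivative_continuous)
    show ?thesis
    proof (rule Bochner_Integration.integrable_bound)
      show "integrable M (\<lambda>\<omega>. \<bar>f (Suc t) \<omega> v\<bar> + L * (sqrt n * D))"
        using f_integrable[OF v] by simp
      show "(\<lambda>\<omega>. f (Suc t) \<omega> (x (Suc t) \<omega>)) \<in> borel_measurable M"
        by (rule borel_measurable_caratheodory[OF borel_measurable_integrable[OF f_integrable] cont x_meas xX])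
      show "AE \<omega> in M. norm (f (Suc t) \<omega> (x (Suc t) \<omega>)) \<le> norm (\<bar>f (Suc t) \<omega> v\<bar> + L * (sqrt n * D))"
      proof (rule AE_I2)
        fix \<omega> assume \<omega>: "\<omega> \<in> space M"
        show "norm (f (Suc t) \<omega> (x (Suc t) \<omega>)) \<le> norm (\<bar>f (Suc t) \<omega> v\<bar> + L * (sqrt n * D))"
          using lipschitz[OF \<omega> xX[OF \<omega>] v, of "Suc t" t] lipschitz[OF \<omega> v xX[OF \<omega>], of "Suc t" t]
          unfolding real_norm_def by linarith
      qed
    qed
  qed

  \<comment> \<open>Expected regret against a fixed comparator\<close>
  have bound: "(\<Sum>t<T. expectation (\<lambda>\<omega>. f (Suc t) \<omega> (x (Suc t) \<omega>) - f (Suc t) \<omega> v)) \<le> M2 * sqrt (real T)"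
    if v: "v \<in> X" for v
  proof (cases "L * (sqrt n * D) * sqrt (real T) \<le> C")
    case True
    have "(\<Sum>t<T. expectation (\<lambda>\<omega>. f (Suc t) \<omega> (x (Suc t) \<omega>) - f (Suc t) \<omega> v)) \<le> (\<Sum>t<T. L * (sqrt n * D))"
    proof (rule sum_mono)
      fix t
      have "expectation (\<lambda>\<omega>. f (Suc t) \<omega> (x (Suc t) \<omega>) - f (Suc t) \<omega> v) \<le> expectation (\<lambda>\<omega>. L * (sqrt n * D))"
        by (intro integral_mono Bochner_Integration.integrable_diff fx_int f_integrable[OF v] lipschitz xX v) auto
      then show "expectation (\<lambda>\<omega>. f (Suc t) \<omega> (x (Suc t) \<omega>) - f (Suc t) \<omega> v) \<le> L * (sqrt n * D)"
        by (simp add: prob_space)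
    qed
    also have "\<dots> = (L * (sqrt n * D) * sqrt (real T)) * sqrt (real T)"
      by (simp add: mult.assoc)
    also have "\<dots> \<le> M2 * sqrt (real T)" using True M2_ge by (intro mult_right_mono) auto
    finally show ?thesis .
  next
    case False
    define s where "s = sqrt (real T)"
    have s: "0 < s" using T by (simp add: s_def)
    have diam_le: "sqrt n * D \<le> 8 * L * s"
    proof (cases "sqrt n * D = 0")
      case False
      have "(sqrt n * D) * (sqrt n * D) = n * D\<^sup>2" using n2 by (simp add: power2_eq_square)
      also have "\<dots> \<le> 8 * C"
        using strongly_convex_diameter_le[OF X c(1,2) psi(2,1) b D diam(2)] by (simp add: n(1))
      also have "\<dots> \<le> 8 * L * s * (sqrt n * D)" using \<open>\<not> _ \<le> C\<close> by (simp add: s_def mult_ac)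
      finally show ?thesis using False diam(2) n2 by (simp add: mult_le_cancel_right)
    qed (use s pos in auto)
    have pointwise: "(\<Sum>t<T. f (Suc t) \<omega> (x (Suc t) \<omega>) - f (Suc t) \<omega> v)
        \<le> (\<Sum>t<T. c1 * step_size t / \<gamma> * W (Suc t) \<omega> + p (Suc t) \<omega> \<bullet> (m t \<omega> - v))"
      if \<omega>: "\<omega> \<in> space M" for \<omega>
    proof (rule sum_mono)
      fix t
      show "f (Suc t) \<omega> (x (Suc t) \<omega>) - f (Suc t) \<omega> v
          \<le> c1 * step_size t / \<gamma> * W (Suc t) \<omega> + p (Suc t) \<omega> \<bullet> (m t \<omega> - v)"
        using dpsda_run.loss_difference_le[OF run[OF \<omega>] wb(1,3) a[OF \<omega>] gradient[OF \<omega>] d[OF \<omega>] e[OF \<omega>]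
            less_imp_le[OF pos(4)] diam(1) xX[OF \<omega>] v, of t]
        by (simp add: m_eq[OF \<omega>] W_def p_def c1_def n(1))
    qed
    have dual: "(\<Sum>t<T. g (Suc t) \<omega> \<bullet> (m t \<omega> - v))
        \<le> norm (g 0 \<omega>) * (sqrt n * D) + s * psi v + (\<Sum>t<T. step_size t / 2 * (norm (g (Suc t) \<omega>))\<^sup>2)"
      if \<omega>: "\<omega> \<in> space M" for \<omega>
    proof -
      have "1 / step_size T = s" using T by (simp add: step_size_def s_def)
      then show ?thesis
        using dpsda_run.sum_avg_input_le[OF run[OF \<omega>] v dist_le[OF v], of T]
        by (simp add: m_eq[OF \<omega>] g_def)
    qed
    have step: "(\<Sum>t<T. step_size t) \<le> 2 * s" unfolding s_def by (rule sum_step_size_le[OF T])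
    have d_int: "integrable M (\<lambda>\<omega>. f (Suc t) \<omega> (x (Suc t) \<omega>) - f (Suc t) \<omega> v)" for t
      using fx_int f_integrable[OF v] by auto
    have w_int: "integrable M (\<lambda>\<omega>. c1 * step_size t / \<gamma> * W (Suc t) \<omega>)" for t
      using W_int by (rule integrable_mult_right)
    have "(\<Sum>t<T. expectation (\<lambda>\<omega>. f (Suc t) \<omega> (x (Suc t) \<omega>) - f (Suc t) \<omega> v))
        = expectation (\<lambda>\<omega>. \<Sum>t<T. f (Suc t) \<omega> (x (Suc t) \<omega>) - f (Suc t) \<omega> v)"
      by (rule Bochner_Integration.integral_sum[OF d_int, symmetric])
    also have "\<dots> \<le> expectation (\<lambda>\<omega>. \<Sum>t<T. c1 * step_size t / \<gamma> * W (Suc t) \<omega> + p (Suc t) \<omega> \<bullet> (m t \<omega> - v))"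
      by (intro integral_mono Bochner_Integration.integrable_sum Bochner_Integration.integrable_add
          d_int w_int unbiased(1)[OF v] pointwise)
    also have "\<dots> = (\<Sum>t<T. expectation (\<lambda>\<omega>. c1 * step_size t / \<gamma> * W (Suc t) \<omega>)
        + expectation (\<lambda>\<omega>. p (Suc t) \<omega> \<bullet> (m t \<omega> - v)))"
      using w_int unbiased(1)[OF v]
      by (subst Bochner_Integration.integral_sum) (auto intro!: sum.cong Bochner_Integration.integral_add)
    \<comment> \<open>The losses bring in \<open>p\<close>, whereas dual averaging controls the
      noisy inputs \<open>g\<close>. They agree here only in expectation, so the exchange is made
      after integrating each summand.\<close>
    also have "\<dots> = (\<Sum>t<T. c1 * step_size t / \<gamma> * expectation (W (Suc t)))
        + (\<Sum>t<T. expectation (\<lambda>\<omega>. g (Suc t) \<omega> \<bullet> (m t \<omega> - v)))"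
      unfolding unbiased(3)[OF v] integral_mult_right_zero by (rule sum.distrib)
    finally have split: "(\<Sum>t<T. expectation (\<lambda>\<omega>. f (Suc t) \<omega> (x (Suc t) \<omega>) - f (Suc t) \<omega> v)) \<le> \<dots>" .
    have network: "(\<Sum>t<T. c1 * step_size t / \<gamma> * expectation (W (Suc t))) \<le> (L + sqrt n * D * G) * sqrt Q * s"
    proof -
      have "(\<Sum>t<T. c1 * step_size t / \<gamma> * expectation (W (Suc t))) \<le> (\<Sum>t<T. c1 * step_size t / \<gamma> * (S * r))"
        using c1 wb(1) less_imp_le[OF step_size_pos] by (intro sum_mono mult_left_mono W_le) simp
      also have "\<dots> = c1 / \<gamma> * (S * r) * (\<Sum>t<T. step_size t)"
        unfolding sum_distrib_left by (intro sum.cong) simp_all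
      also have "\<dots> \<le> c1 / \<gamma> * (S * r) * (2 * s)"
        using step c1 wb(1) S0 r0 by (intro mult_left_mono) auto
      also have "\<dots> = (L + sqrt n * D * G) * (2 * (sqrt n * (S * r / \<gamma>))) * s"
        by (simp add: c1_def)
      also have "\<dots> \<le> (L + sqrt n * D * G) * sqrt Q * s"
        using netQ LDG pos s by (intro mult_right_mono mult_left_mono) auto
      finally show ?thesis .
    qed
    have "(\<Sum>t<T. expectation (\<lambda>\<omega>. g (Suc t) \<omega> \<bullet> (m t \<omega> - v)))
        = expectation (\<lambda>\<omega>. \<Sum>t<T. g (Suc t) \<omega> \<bullet> (m t \<omega> - v))"
      by (rule Bochner_Integration.integral_sum[OF unbiased(2)[OF v], symmetric])
    also have "\<dots> \<le> expectation (\<lambda>\<omega>. norm (g 0 \<omega>) * (sqrt n * D) + s * psi v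
        + (\<Sum>t<T. step_size t / 2 * (norm (g (Suc t) \<omega>))\<^sup>2))"
      by (intro integral_mono Bochner_Integration.integrable_sum Bochner_Integration.integrable_add
          unbiased(2)[OF v] dual integrable_mult_left integrable_mult_right g_norm_int g_sq_int integrable_const)
    also have "\<dots> = expectation (\<lambda>\<omega>. norm (g 0 \<omega>)) * (sqrt n * D) + s * psi v
        + (\<Sum>t<T. step_size t / 2 * expectation (\<lambda>\<omega>. (norm (g (Suc t) \<omega>))\<^sup>2))"
      using g_norm_int g_sq_int by (simp add: prob_space)
    also have "\<dots> \<le> sqrt K * (8 * L * s) + s * C + (\<Sum>t<T. step_size t / 2 * K)"
    proof (intro add_mono)
      show "expectation (\<lambda>\<omega>. norm (g 0 \<omega>)) * (sqrt n * D) \<le> sqrt K * (8 * L * s)"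
        using K0 diam(2) n2 by (intro mult_mono g_norm_le diam_le) auto
      show "s * psi v \<le> s * C" using b[OF v] s by simp
      show "(\<Sum>t<T. step_size t / 2 * expectation (\<lambda>\<omega>. (norm (g (Suc t) \<omega>))\<^sup>2)) \<le> (\<Sum>t<T. step_size t / 2 * K)"
        using less_imp_le[OF step_size_pos] by (intro sum_mono mult_left_mono g_sq_le) simp
    qed
    \<comment> \<open>Half of \<open>K\<close> times a step-size sum of at most \<open>2 * s\<close>
      gives \<open>K * s\<close>.\<close>
    also have "\<dots> \<le> sqrt K * (8 * L * s) + s * C + K * s"
      using mult_left_mono[OF step K0] by (simp add: sum_distrib_left mult_ac flip: sum_divide_distrib)
    \<comment> \<open>The price of the input at time 0 fits into the second half of the last term of
      \<open>M2\<close>, by \<open>8 * sqrt K \<le> sqrt Q\<close>.\<close>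
    also have "sqrt K * (8 * L * s) \<le> (L + sqrt n * D * G) * sqrt Q * s"
    proof -
      have "sqrt K * (8 * L * s) = L * (8 * sqrt K) * s" by simp
      also have "\<dots> \<le> (L + sqrt n * D * G) * sqrt Q * s"
        using KQ LDG pos s K0 by (intro mult_right_mono mult_mono) auto
      finally show ?thesis .
    qed
    finally have "(\<Sum>t<T. expectation (\<lambda>\<omega>. g (Suc t) \<omega> \<bullet> (m t \<omega> - v)))
        \<le> (L + sqrt n * D * G) * sqrt Q * s + s * C + K * s" by simp
    then show ?thesis
      using split network by (simp add: M2_eq s_def algebra_simps)
  qed
  \<comment> \<open>Written as a lower bound for the comparator's expected loss that is uniform in
    \<open>v\<close>, so that it passes directly to the infimum.\<close>
  have key: "expectation (\<lambda>\<omega>. \<Sum>t=1..T. f t \<omega> (x t \<omega>)) - M2 * sqrt (real T) \<le> expectation (\<lambda>\<omega>. \<Sum>t=1..T. f t \<omega> v)"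
    if v: "v \<in> X" for v
  proof -
    have "expectation (\<lambda>\<omega>. \<Sum>t=1..T. f t \<omega> (x t \<omega>)) = (\<Sum>t<T. expectation (\<lambda>\<omega>. f (Suc t) \<omega> (x (Suc t) \<omega>)))"
      unfolding One_nat_def sum.atLeast1_atMost_eq by (rule Bochner_Integration.integral_sum[OF fx_int])
    moreover have "expectation (\<lambda>\<omega>. \<Sum>t=1..T. f t \<omega> v) = (\<Sum>t<T. expectation (\<lambda>\<omega>. f (Suc t) \<omega> v))"
      unfolding One_nat_def sum.atLeast1_atMost_eq by (rule Bochner_Integration.integral_sum[OF f_integrable[OF v]])
    moreover have "(\<Sum>t<T. expectation (\<lambda>\<omega>. f (Suc t) \<omega> (x (Suc t) \<omega>) - f (Suc t) \<omega> v))
        = (\<Sum>t<T. expectation (\<lambda>\<omega>. f (Suc t) \<omega> (x (Suc t) \<omega>))) - (\<Sum>t<T. expectation (\<lambda>\<omega>. f (Suc t) \<omega> v))"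
      using fx_int f_integrable[OF v] by (simp add: sum_subtractf)
    ultimately show ?thesis using bound[OF v] by linarith
  qed
  have "expectation (\<lambda>\<omega>. \<Sum>t=1..T. f t \<omega> (x t \<omega>)) - M2 * sqrt (real T)
      \<le> (INF v\<in>X. expectation (\<lambda>\<omega>. \<Sum>t=1..T. f t \<omega> v))"
    by (rule cINF_greatest[OF c(1) key])
  then show ?thesis unfolding pseudo_regret_def by simp
qed

end
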